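(* Let $n\ge 3$ be an integer and let $C_n$ be the cycle on $n$ vertices. Then $o(C_n)=\mathcal{D}$ if and only if $n\ge 10$ and $n\equiv 1 \pmod 3$; otherwise $o(C_n)=\mathcal{A}$.
   Context: The Maker-Maker domination game on a finite simple graph $G$: two players, Alice and Bob, alternately claim a previously unclaimed vertex of $G$, Alice first. A set of vertices is dominating if every vertex of $G$ is in it or adjacent to one of its vertices. The first player whose set of claimed vertices dominates $G$ wins; if all vertices are claimed and neither player has claimed a dominating set, the game is a draw. $o(G)=\mathcal{A}$ if Alice has a winning strategy, and $o(G)=\mathcal{D}$ otherwise (the second player never has a winning strategy). *)

theory Defs
  imports "Graph_Theory.Pair_Digraph" "HOL-Number_Theory.Cong"
begin

text \<open>
  Finite simple graphs are the \<^locale>\<open>pair_graph\<close>s: finite, loop-free, and with a symmetric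
  set of arcs.
\<close>

definition dominating :: "'a pair_pre_digraph \<Rightarrow> 'a set \<Rightarrow> bool" where
  "dominating G S \<longleftrightarrow>
     S \<subseteq> pverts G \<and> (\<forall>v\<in>pverts G. v \<in> S \<or> (\<exists>u\<in>S. (u, v) \<in> parcs G))"

text \<open>
  A play is recorded as the list of claimed vertices in chronological order; Alice makes the moves
  at even positions (counting from 0), Bob those at odd positions.
\<close>

definition alice_claimed :: "'a list \<Rightarrow> 'a set" where
  "alice_claimed h = {h ! i | i. i < length h \<and> even i}"

definition bob_claimed :: "'a list \<Rightarrow> 'a set" where
  "bob_claimed h = {h ! i | i. i < length h \<and> odd i}"

definition game_over :: "'a pair_pre_digraph \<Rightarrow> 'a list \<Rightarrow> bool" where
  "game_over G h \<longleftrightarrow>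
     dominating G (alice_claimed h) \<or> dominating G (bob_claimed h) \<or> set h = pverts G"

text \<open>A possibly unfinished play: it stops as soon as a player dominates.\<close>

definition legal_play :: "'a pair_pre_digraph \<Rightarrow> 'a list \<Rightarrow> bool" where
  "legal_play G h \<longleftrightarrow>
     distinct h \<and> set h \<subseteq> pverts G \<and> (\<forall>k<length h. \<not> game_over G (take k h))"

type_synonym 'a strategy = "'a list \<Rightarrow> 'a"

definition alice_follows :: "'a strategy \<Rightarrow> 'a list \<Rightarrow> bool" where
  "alice_follows \<sigma> h \<longleftrightarrow> (\<forall>i<length h. even i \<longrightarrow> h ! i = \<sigma> (take i h))"

text \<open>
  At the end of a legal play at most one player dominates a nonempty graph, so the first player to
  dominate is the one whose final set is dominating.
\<close>

definition alice_winning_strategy :: "'a pair_pre_digraph \<Rightarrow> 'a strategy \<Rightarrow> bool" where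
  "alice_winning_strategy G \<sigma> \<longleftrightarrow>
     (\<forall>h. legal_play G h \<and> alice_follows \<sigma> h \<longrightarrow>
        (if game_over G h then dominating G (alice_claimed h)
         else even (length h) \<longrightarrow> \<sigma> h \<in> pverts G - set h))"

datatype outcome = \<A> | \<D>

definition outcome :: "'a pair_pre_digraph \<Rightarrow> outcome" where
  "outcome G = (if \<exists>\<sigma>. alice_winning_strategy G \<sigma> then \<A> else \<D>)"

definition cycle_graph :: "nat \<Rightarrow> nat pair_pre_digraph" where
  "cycle_graph n =
     \<lparr> pverts = {0..<n},
       parcs = {(i, j). i < n \<and> j < n \<and> (j = (i + 1) mod n \<or> i = (j + 1) mod n)} \<rparr>"

lemma pair_graph_cycle_graph:
  assumes "n \<ge> 3"
  shows "pair_graph (cycle_graph n)"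
proof
  show "finite (parcs (cycle_graph n))"
    by (rule finite_subset[of _ "{0..<n} \<times> {0..<n}"]) (auto simp: cycle_graph_def)
next
  fix e assume "e \<in> parcs (cycle_graph n)"
  then show "fst e \<noteq> snd e"
    using assms by (cases "Suc (fst e) = n") (auto simp: cycle_graph_def)
qed (auto simp: cycle_graph_def symmetric_def sym_def)

end

theory Submission
  imports Defs
begin

text \<open>
  A player dominates the cycle iff no three consecutive vertices are free of her stones. Consider the
  gaps between consecutive stones, and suppose that the responder \<open>P\<close> has a stone next to every
  stone of the mover \<open>Q\<close> and that no gap lies between two stones of \<open>Q\<close>. A gap of length \<open>L\<close> between
  two \<open>P\<close> stones needs \<open>\<lceil>(L - 2) / 3\<rceil>\<close> more stones of \<open>P\<close> but \<open>\<lceil>L / 3\<rceil>\<close> of \<open>Q\<close>, while a gap with ends of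
  different owners needs the same number for both. So one gap of the first kind with \<open>L\<close> not divisible
  by 3 keeps \<open>P\<close> a tempo ahead, and \<open>P\<close> can preserve such a gap by answering next to the last stone
  of \<open>Q\<close>. After Alice's first move the only gap has length \<open>n - 1\<close>, which settles the case that \<open>n\<close> is
  not 1 modulo 3; the exceptions 4 and 7 are too short for Bob's plan.

  If \<open>n \<ge> 10\<close> is 1 modulo 3, Bob answers at distance 5 from Alice's stone, which forces Alice to play
  next to him. Depending on the side, a sequence of threats to claim three consecutive vertices either
  wins the race outright or leaves a single gap between two stones of Alice, of length divisible by
  3. There Bob plays at distance 2 from the end and reaches a position in which he is the responder \<open>P\<close>.
\<close>

section \<open>Strategies from invariants\<close>

lemma nth_image_snoc:
  "{(h @ [x]) ! i | i. i < length (h @ [x]) \<and> p i} =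
    (if p (length h) then insert x {h ! i | i. i < length h \<and> p i} else {h ! i | i. i < length h \<and> p i})"
proof -
  have image: "{g ! i | i. i < length g \<and> p i} = (!) g ` {i. i < length g \<and> p i}" for g :: "'a list"
    by blast
  have "{i. i < length (h @ [x]) \<and> p i} =
      {i. i < length h \<and> p i} \<union> (if p (length h) then {length h} else {})"
    by (auto simp: less_Suc_eq)
  moreover have "(!) (h @ [x]) ` {i. i < length h \<and> p i} = (!) h ` {i. i < length h \<and> p i}"
    by (intro image_cong) (auto simp: nth_append)
  ultimately show ?thesis unfolding image by simp
qed

lemma alice_claimed_snoc:
  "alice_claimed (h @ [x]) = (if even (length h) then insert x (alice_claimed h) else alice_claimed h)"
  unfolding alice_claimed_def by (rule nth_image_snoc)

lemma bob_claimed_snoc: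
  "bob_claimed (h @ [x]) = (if even (length h) then bob_claimed h else insert x (bob_claimed h))"
  unfolding bob_claimed_def nth_image_snoc[where p = odd] by simp

lemma alice_claimed_Nil [simp]: "alice_claimed [] = {}"
  and bob_claimed_Nil [simp]: "bob_claimed [] = {}"
  by (simp_all add: alice_claimed_def bob_claimed_def)

lemma claimed_Un: "alice_claimed h \<union> bob_claimed h = set h"
  by (induction h rule: rev_induct) (auto simp: alice_claimed_snoc bob_claimed_snoc)

lemma legal_play_snoc:
  "legal_play G (h @ [x]) \<longleftrightarrow> legal_play G h \<and> \<not> game_over G h \<and> x \<in> pverts G - set h"
proof -
  have "(\<forall>k<length (h @ [x]). \<not> game_over G (take k (h @ [x]))) \<longleftrightarrow>
      (\<forall>k<length h. \<not> game_over G (take k h)) \<and> \<not> game_over G h"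
    by (auto simp: less_Suc_eq)
  then show ?thesis unfolding legal_play_def by auto
qed

lemma alice_follows_snoc:
  "alice_follows \<sigma> (h @ [x]) \<longleftrightarrow> alice_follows \<sigma> h \<and> (even (length h) \<longrightarrow> x = \<sigma> h)"
  unfolding alice_follows_def by (auto simp: less_Suc_eq nth_append)

text \<open>\<open>I\<close> describes positions just after a move of Alice. Since
  \<open>step\<close> is only demanded while she does not dominate, positions that she has won may
  be included in \<open>I\<close> at no cost.\<close>

lemma alice_winning_strategy_from_invariant:
  assumes a: "a \<in> pverts G" "I {a} {}"
    and step: "\<And>A B. I A B \<Longrightarrow> A \<union> B \<subseteq> pverts G \<Longrightarrow> \<not> dominating G A \<Longrightarrow>
      A \<union> B \<noteq> pverts G \<and> (\<forall>x\<in>pverts G - (A \<union> B). \<not> dominating G (insert x B) \<and>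
        (\<exists>y\<in>pverts G - (A \<union> insert x B). I (insert y A) (insert x B)))"
  shows "\<exists>\<sigma>. alice_winning_strategy G \<sigma>"
proof -
  \<comment> \<open>The strategy picks any free vertex that restores \<open>I\<close>;
    \<open>inv\<close> shows along every play that one exists whenever it is Alice's turn.\<close>
  define good where "good h y \<longleftrightarrow> y \<in> pverts G - set h \<and> I (insert y (alice_claimed h)) (bob_claimed h)" for h y
  define \<sigma> where "\<sigma> h = (SOME y. good h y)" for h
  have inv: "if even (length h) then (\<exists>y. good h y) \<and> \<not> game_over G h else I (alice_claimed h) (bob_claimed h)"
    if "legal_play G h" "alice_follows \<sigma> h" for h
    using that
  proof (induction h rule: rev_induct)
    case Nil
    have "\<not> game_over G []" using a unfolding game_over_def dominating_def by auto
    then show ?case using a unfolding good_def by auto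
  next
    case (snoc x h)
    then have h: "legal_play G h" "\<not> game_over G h" "x \<in> pverts G - set h" "alice_follows \<sigma> h"
      and x: "even (length h) \<Longrightarrow> x = \<sigma> h"
      by (auto simp: legal_play_snoc alice_follows_snoc)
    note IH = snoc.IH[OF h(1,4)]
    show ?case
    proof (cases "even (length h)")
      case True
      then have "good h x" using IH x unfolding \<sigma>_def by (auto intro: someI_ex)
      then show ?thesis using True unfolding good_def by (simp add: alice_claimed_snoc bob_claimed_snoc)
    next
      case False
      let ?A = "alice_claimed h" and ?B = "bob_claimed h"
      have sub: "?A \<union> ?B \<subseteq> pverts G" using h(1) claimed_Un[of h] unfolding legal_play_def by simp
      have nd: "\<not> dominating G ?A" using h(2) unfolding game_over_def by blast
      have x': "x \<in> pverts G - (?A \<union> ?B)" using h(3) claimed_Un[of h] by simp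
      have I: "I ?A ?B" using IH False by simp
      obtain y where y: "\<not> dominating G (insert x ?B)" "y \<in> pverts G - (?A \<union> insert x ?B)"
          "I (insert y ?A) (insert x ?B)"
        using step[OF I sub nd] x' by blast
      have "good (h @ [x]) y"
        unfolding good_def using y False claimed_Un[of h] by (auto simp: alice_claimed_snoc bob_claimed_snoc)
      moreover from this have "\<not> game_over G (h @ [x])"
        unfolding game_over_def good_def using y(1) nd False by (auto simp: alice_claimed_snoc bob_claimed_snoc)
      ultimately show ?thesis using False by auto
    qed
  qed
  have "alice_winning_strategy G \<sigma>"
    unfolding alice_winning_strategy_def
  proof (intro allI impI)
    fix h assume h: "legal_play G h \<and> alice_follows \<sigma> h"
    show "if game_over G h then dominating G (alice_claimed h)
        else even (length h) \<longrightarrow> \<sigma> h \<in> pverts G - set h"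
    proof (cases "even (length h)")
      case True
      then have "good h (\<sigma> h)" "\<not> game_over G h"
        using inv[of h] h unfolding \<sigma>_def by (auto intro: someI_ex)
      then show ?thesis unfolding good_def by simp
    next
      case False
      then have I: "I (alice_claimed h) (bob_claimed h)" using inv h by auto
      obtain g x where g: "h = g @ [x]" using False by (cases h rule: rev_cases) auto
      \<comment> \<open>The last move is Alice's, so Bob's set is that of the unfinished play
        \<open>g\<close>. As \<open>step\<close> also provides a free vertex, the play can only be
        over because Alice dominates.\<close>
      then have "bob_claimed h = bob_claimed g" "\<not> game_over G g"
        using False h by (auto simp: bob_claimed_snoc legal_play_snoc)
      then have "\<not> dominating G (bob_claimed h)" unfolding game_over_def by simp
      moreover have "alice_claimed h \<union> bob_claimed h \<subseteq> pverts G"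
        using h claimed_Un[of h] unfolding legal_play_def by simp
      ultimately show ?thesis using step[OF I] claimed_Un[of h] False unfolding game_over_def by auto
    qed
  qed
  then show ?thesis by blast
qed

text \<open>\<open>J\<close> describes positions with Alice to move. Plays are bounded in length, so
  there is a longest one that follows the strategy and ends in \<open>J\<close>. One more round
  extends it unless Bob dominates or the board fills up, and either contradicts a winning
  strategy.\<close>

lemma no_alice_winning_strategy_from_invariant:
  assumes fin: "finite (pverts G)" and J0: "J {} {}"
    and step: "\<And>A B. J A B \<Longrightarrow> A \<union> B \<subseteq> pverts G \<Longrightarrow> \<not> dominating G A \<and>
      (\<forall>y\<in>pverts G - (A \<union> B). \<not> dominating G (insert y A) \<and>
        (insert y A \<union> B = pverts G \<or>
         (\<exists>x\<in>pverts G - (insert y A \<union> B). dominating G (insert x B) \<or> J (insert y A) (insert x B))))"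
  shows "\<not> alice_winning_strategy G \<sigma>"
proof
  assume win: "alice_winning_strategy G \<sigma>"
  let ?R = "\<lambda>h. legal_play G h \<and> alice_follows \<sigma> h \<and> even (length h) \<and> J (alice_claimed h) (bob_claimed h)"
  have "?R []" using J0 unfolding legal_play_def alice_follows_def by simp
  moreover have bound: "length h \<le> card (pverts G)" if "?R h" for h
    using that fin unfolding legal_play_def by (metis card_mono distinct_card)
  ultimately obtain h where h: "?R h" and max: "\<And>g. ?R g \<Longrightarrow> length g \<le> length h"
    using ex_has_greatest_nat[of ?R "[]" length "Suc (card (pverts G))"] by (metis less_Suc_eq_le)
  have W: "if game_over G g then dominating G (alice_claimed g) else even (length g) \<longrightarrow> \<sigma> g \<in> pverts G - set g"
    if "legal_play G g" "alice_follows \<sigma> g" for g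
    using win that unfolding alice_winning_strategy_def by blast
  let ?A = "alice_claimed h" and ?B = "bob_claimed h"
  have sub: "?A \<union> ?B \<subseteq> pverts G" using h claimed_Un[of h] unfolding legal_play_def by simp
  note S = step[OF _ sub]
  have ng: "\<not> game_over G h" using W[of h] h S by (metis (full_types))
  define y where "y = \<sigma> h"
  have y: "y \<in> pverts G - set h" using W[of h] h ng unfolding y_def by auto
  have g1: "legal_play G (h @ [y])" "alice_follows \<sigma> (h @ [y])"
    using h ng y by (auto simp: legal_play_snoc alice_follows_snoc y_def)
  have c1: "alice_claimed (h @ [y]) = insert y ?A" "bob_claimed (h @ [y]) = ?B"
    using h by (simp_all add: alice_claimed_snoc bob_claimed_snoc)
  have y': "y \<in> pverts G - (?A \<union> ?B)" using y claimed_Un[of h] by simp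
  have nd: "\<not> dominating G (insert y ?A)" using S h y' by blast
  have ng1: "\<not> game_over G (h @ [y])" using W[OF g1] nd c1 by (auto split: if_splits)
  then have "insert y ?A \<union> ?B \<noteq> pverts G"
    using claimed_Un[of "h @ [y]"] c1 unfolding game_over_def by auto
  then obtain x where x: "x \<in> pverts G - (insert y ?A \<union> ?B)"
      "dominating G (insert x ?B) \<or> J (insert y ?A) (insert x ?B)"
    using S h y' by blast
  have "x \<in> pverts G - set (h @ [y])" using x(1) claimed_Un[of h] by auto
  then have g2: "legal_play G (h @ [y] @ [x])" "alice_follows \<sigma> (h @ [y] @ [x])"
    using h g1 ng1 legal_play_snoc[of G "h @ [y]" x] alice_follows_snoc[of \<sigma> "h @ [y]" x] by auto
  have c2: "alice_claimed (h @ [y] @ [x]) = insert y ?A" "bob_claimed (h @ [y] @ [x]) = insert x ?B"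
    using h c1 alice_claimed_snoc[of "h @ [y]" x] bob_claimed_snoc[of "h @ [y]" x] by auto
  from x(2) show False
  proof
    assume "dominating G (insert x ?B)"
    then have "game_over G (h @ [y] @ [x])" unfolding game_over_def c2 by blast
    then show False using W[OF g2] nd c2 by simp
  next
    assume "J (insert y ?A) (insert x ?B)"
    then have "?R (h @ [y] @ [x])" using g2 c2 h by simp
    then show False using max by force
  qed
qed

section \<open>The responder wins the race\<close>

text \<open>
  Sets of vertices of the cycle are represented by \<open>n\<close>-periodic sets of integers, and \<open>cls x\<close> is a
  single vertex. Neighbours are then \<open>x - 1\<close> and \<open>x + 1\<close>, and gaps are intervals.
\<close>

locale circle =
  fixes n :: int
  assumes n_ge_3: "n \<ge> 3"
begin

section \<open>Periodic sets, residue classes and gaps\<close>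

definition periodic :: "int set \<Rightarrow> bool" where
  "periodic S \<longleftrightarrow> (\<forall>i k. i + n * k \<in> S \<longleftrightarrow> i \<in> S)"

definition cls :: "int \<Rightarrow> int set" where
  "cls x = {i. n dvd i - x}"

definition covers :: "int set \<Rightarrow> bool" where
  "covers S \<longleftrightarrow> (\<forall>i. i - 1 \<in> S \<or> i \<in> S \<or> i + 1 \<in> S)"

text \<open>Both ends are excluded, so a gap is given by the stones \<open>i\<close> and
  \<open>j\<close> that bound it and has \<open>j - i - 1\<close> vertices. The ends may be two
  copies of the same stone.\<close>

definition vacant :: "int set \<Rightarrow> int \<Rightarrow> int \<Rightarrow> bool" where
  "vacant U i j \<longleftrightarrow> (\<forall>k. i < k \<longrightarrow> k < j \<longrightarrow> k \<notin> U)"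

lemma periodic_shift: "periodic S \<Longrightarrow> i + n * k \<in> S \<longleftrightarrow> i \<in> S"
  unfolding periodic_def by blast

lemma periodicD: "periodic S \<Longrightarrow> n dvd i - x \<Longrightarrow> i \<in> S \<longleftrightarrow> x \<in> S"
  unfolding periodic_def by (metis add.commute diff_add_cancel dvd_def)

lemma periodic_cls [simp]: "periodic (cls x)"
proof -
  have "i + n * k - x = (i - x) + n * k" for i k by simp
  then show ?thesis unfolding periodic_def cls_def by (simp only: mem_Collect_eq dvd_add_left_iff dvd_triv_left simp_thms)
qed

lemma periodic_empty [simp]: "periodic {}"
  by (simp add: periodic_def)

lemma periodic_Un [simp]: "periodic S \<Longrightarrow> periodic T \<Longrightarrow> periodic (S \<union> T)"
  by (simp add: periodic_def)

lemma cls_self [simp]: "x \<in> cls x"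
  by (simp add: cls_def)

lemma cls_disjoint: "periodic S \<Longrightarrow> cls x \<inter> S = {} \<longleftrightarrow> x \<notin> S"
  using periodicD[of S _ x] cls_self[of x] unfolding cls_def by blast

lemma clsE: assumes "i \<in> cls x" obtains k where "i = x + n * k"
proof -
  from assms obtain k where "i - x = n * k" unfolding cls_def by (auto elim: dvdE)
  then show thesis using that[of k] by simp
qed

lemma cls_cong: "i \<in> cls x \<Longrightarrow> j \<in> cls x \<Longrightarrow> i \<in> cls j"
  unfolding cls_def using dvd_diff[of n "i - x" "j - x"] by simp

lemma cls_near: "i \<in> cls x \<Longrightarrow> x - n < i \<Longrightarrow> i < x + n \<Longrightarrow> i = x"
  using dvd_imp_le_int[of "i - x" n] n_ge_3 unfolding cls_def by fastforce

lemma cls_far: "i \<in> cls x \<Longrightarrow> i < x \<Longrightarrow> i \<le> x - n"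
  "i \<in> cls x \<Longrightarrow> x < i \<Longrightarrow> x + n \<le> i"
  using cls_near[of i x] n_ge_3 by linarith+

lemma nearest_left:
  assumes "periodic U" "U \<noteq> {}" "x \<notin> U"
  obtains i where "i \<in> U" "i < x" "vacant U i x"
proof -
  obtain u where u: "u \<in> U" using assms(2) by blast
  \<comment> \<open>Moving \<open>u\<close> left by \<open>\<bar>u\<bar> + \<bar>x\<bar>\<close>
    periods brings it to \<open>x\<close> or beyond, so the nearest stone is a maximum over a finite
    set.\<close>
  define v where "v = u + n * (- (\<bar>u\<bar> + \<bar>x\<bar>))"
  have "\<bar>u\<bar> + \<bar>x\<bar> \<le> n * (\<bar>u\<bar> + \<bar>x\<bar>)"
    using n_ge_3 mult_right_mono[of 1 n "\<bar>u\<bar> + \<bar>x\<bar>"] by simp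
  then have v: "v \<in> U" "v \<le> x"
    using u periodic_shift[OF assms(1), of u "- (\<bar>u\<bar> + \<bar>x\<bar>)"] unfolding v_def mult_minus_right
    by (simp, linarith)
  define M where "M = Max (U \<inter> {v..x})"
  have fin: "finite (U \<inter> {v..x})" by simp
  have "M \<in> U \<inter> {v..x}"
    unfolding M_def by (rule Max_in) (use v fin in auto)
  moreover have "vacant U M x"
  proof (rule ccontr)
    assume "\<not> vacant U M x"
    then obtain k where k: "k \<in> U" "M < k" "k < x" unfolding vacant_def by blast
    then have "k \<in> U \<inter> {v..x}" using \<open>M \<in> U \<inter> {v..x}\<close> by auto
    then have "k \<le> M" unfolding M_def using fin by (rule Max_ge[rotated])
    with k show False by simp
  qed
  ultimately show thesis using assms(3) that[of M] by (metis IntD1 IntD2 atLeastAtMost_iff order_le_less)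
qed

section \<open>Reflection, which exchanges the two ends of a gap\<close>

definition reflect :: "int set \<Rightarrow> int set" where
  "reflect S = {i. - i \<in> S}"

lemma reflect_iff [simp]: "i \<in> reflect S \<longleftrightarrow> - i \<in> S"
  by (simp add: reflect_def)

lemma reflect_reflect [simp]: "reflect (reflect S) = S"
  by (auto simp: reflect_def)

lemma reflect_Un [simp]: "reflect (S \<union> T) = reflect S \<union> reflect T"
  by (auto simp: reflect_def)

lemma reflect_cls [simp]: "reflect (cls x) = cls (- x)"
proof -
  have "n dvd - i - x \<longleftrightarrow> n dvd i + x" for i
    using dvd_minus_iff[of n "i + x"] by simp
  then show ?thesis by (auto simp: reflect_def cls_def)
qed

lemma vacant_reflect: "vacant (reflect S) i j \<longleftrightarrow> vacant S (-j) (-i)"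
  unfolding vacant_def reflect_iff by (metis add.inverse_inverse neg_less_iff_less)

lemma periodic_reflect [simp]: "periodic (reflect S) \<longleftrightarrow> periodic S"
proof -
  have "periodic (reflect S)" if "periodic S" for S
    using periodicD[OF that] unfolding periodic_def reflect_iff by simp
  from this[of S] this[of "reflect S"] show ?thesis by auto
qed

lemma nearest_right:
  assumes "periodic U" "U \<noteq> {}" "x \<notin> U"
  obtains j where "j \<in> U" "x < j" "vacant U x j"
proof -
  have "reflect U \<noteq> {}"
    using assms(2) by (metis all_not_in_conv minus_minus reflect_iff)
  then obtain i where "i \<in> reflect U" "i < - x" "vacant (reflect U) i (- x)"
    using nearest_left[of "reflect U" "- x"] assms by auto
  then show thesis
    using that[of "- i"] vacant_reflect[of U i "- x"] by simp
qed

section \<open>Sound positions, sources and the effect of new stones\<close>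

text \<open>\<open>P\<close> and \<open>Q\<close> are kept apart from Alice and Bob because either
  of them can become the responder. The condition \<open>i + 1 < j\<close> exempts adjacent stones
  of \<open>Q\<close>, which enclose no vertex.\<close>

definition sound :: "int set \<Rightarrow> int set \<Rightarrow> bool" where
  "sound P Q \<longleftrightarrow> periodic P \<and> periodic Q \<and> P \<inter> Q = {} \<and> P \<noteq> {} \<and>
     (\<forall>i\<in>Q. i - 1 \<in> P \<or> i + 1 \<in> P) \<and>
     (\<forall>i\<in>Q. \<forall>j\<in>Q. i + 1 < j \<longrightarrow> \<not> vacant (P \<union> Q) i j)"

text \<open>
  In the second alternative \<open>Q\<close> still has to dominate the isolated stone \<open>g\<close>, which costs a tempo as
  well.
\<close>

definition source :: "int set \<Rightarrow> int set \<Rightarrow> bool" where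
  "source P Q \<longleftrightarrow>
     (\<exists>i\<in>P. \<exists>j\<in>P. i < j \<and> vacant (P \<union> Q) i j \<and> (j - i) mod 3 \<noteq> 1) \<or>
     (\<exists>g\<in>P. g - 1 \<notin> P \<union> Q \<and> g + 1 \<notin> P \<union> Q \<and> g - 2 \<in> Q \<and> g + 2 \<in> Q)"

lemma reflect_eq_empty [simp]: "reflect S = {} \<longleftrightarrow> S = {}"
  by (metis all_not_in_conv minus_minus reflect_iff)

lemma reflect_Int_empty [simp]: "reflect S \<inter> reflect T = {} \<longleftrightarrow> S \<inter> T = {}"
  by (metis disjoint_iff minus_minus reflect_iff)

lemma sound_reflectI:
  assumes "sound P Q" shows "sound (reflect P) (reflect Q)"
proof -
  have "\<not> vacant (reflect P \<union> reflect Q) i j"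
    if "- i \<in> Q" "- j \<in> Q" "i + 1 < j" for i j
    using assms that vacant_reflect[of "P \<union> Q" i j] unfolding sound_def reflect_Un
    by simp
  moreover have "- (i - 1) \<in> P \<or> - (i + 1) \<in> P" if "- i \<in> Q" for i
  proof -
    have "- i - 1 \<in> P \<or> - i + 1 \<in> P" using assms that unfolding sound_def by blast
    moreover have "- (i - 1) = - i + 1" "- (i + 1) = - i - 1" by simp_all
    ultimately show ?thesis by metis
  qed
  ultimately show ?thesis
    using assms unfolding sound_def by simp
qed

lemma source_reflectI:
  assumes "source P Q" shows "source (reflect P) (reflect Q)"
  using assms unfolding source_def
proof (elim disjE bexE conjE)
  fix i j assume "i \<in> P" "j \<in> P" "i < j" "vacant (P \<union> Q) i j" "(j - i) mod 3 \<noteq> 1"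
  then have "- j \<in> reflect P" "- i \<in> reflect P" "- j < - i"
    "vacant (reflect P \<union> reflect Q) (-j) (-i)" "(- i - - j) mod 3 \<noteq> 1"
    using vacant_reflect[of "P \<union> Q" "-j" "-i"] by simp_all
  then show "(\<exists>i\<in>reflect P. \<exists>j\<in>reflect P. i < j \<and>
      vacant (reflect P \<union> reflect Q) i j \<and> (j - i) mod 3 \<noteq> 1) \<or>
     (\<exists>g\<in>reflect P. g - 1 \<notin> reflect P \<union> reflect Q \<and> g + 1 \<notin> reflect P \<union> reflect Q \<and>
      g - 2 \<in> reflect Q \<and> g + 2 \<in> reflect Q)"
    by blast
next
  fix g assume "g \<in> P" "g - 1 \<notin> P \<union> Q" "g + 1 \<notin> P \<union> Q" "g - 2 \<in> Q" "g + 2 \<in> Q"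
  then have "- g \<in> reflect P" "- g - 1 \<notin> reflect P \<union> reflect Q" "- g + 1 \<notin> reflect P \<union> reflect Q"
      "- g - 2 \<in> reflect Q" "- g + 2 \<in> reflect Q"
    by (simp_all add: add.commute)
  then show "(\<exists>i\<in>reflect P. \<exists>j\<in>reflect P. i < j \<and>
      vacant (reflect P \<union> reflect Q) i j \<and> (j - i) mod 3 \<noteq> 1) \<or>
     (\<exists>g\<in>reflect P. g - 1 \<notin> reflect P \<union> reflect Q \<and> g + 1 \<notin> reflect P \<union> reflect Q \<and>
      g - 2 \<in> reflect Q \<and> g + 2 \<in> reflect Q)"
    by blast
qed

text \<open>Only gaps that end at a copy of \<open>x\<close> are new, and periodicity moves that
  copy to \<open>x\<close> itself, so \<open>L\<close> and \<open>R\<close> are checked at one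
  place. They include \<open>cls x\<close> because both ends may be copies of
  \<open>x\<close>.\<close>

lemma sound_insert:
  assumes s: "sound P Q" and P': "P \<subseteq> P'" "periodic P'" "P' \<inter> Q = {}" and x: "x \<notin> P' \<union> Q"
    and nb: "x - 1 \<in> P' \<or> x + 1 \<in> P'"
    and L: "\<And>i. i \<in> Q \<union> cls x \<Longrightarrow> i + 1 < x \<Longrightarrow> \<not> vacant (P' \<union> Q) i x"
    and R: "\<And>j. j \<in> Q \<union> cls x \<Longrightarrow> x + 1 < j \<Longrightarrow> \<not> vacant (P' \<union> Q) x j"
  shows "sound P' (Q \<union> cls x)"
proof -
  have pO: "periodic Q" and pU: "periodic (P' \<union> Q)" using s P' unfolding sound_def by simp_all
  have "P' \<inter> (Q \<union> cls x) = {}" using P' x cls_disjoint[of P' x] by auto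
  moreover have "i - 1 \<in> P' \<or> i + 1 \<in> P'" if "i \<in> Q \<union> cls x" for i
  proof (cases "i \<in> Q")
    case True then show ?thesis using s P' unfolding sound_def by blast
  next
    case False
    then have "n dvd (i - 1) - (x - 1)" "n dvd (i + 1) - (x + 1)" using that by (auto simp: cls_def)
    then show ?thesis using nb periodicD[OF P'(2)] by blast
  qed
  moreover have "\<not> vacant (P' \<union> (Q \<union> cls x)) i j"
    if ij: "i \<in> Q \<union> cls x" "j \<in> Q \<union> cls x" "i + 1 < j" for i j
  proof -
    have pC: "periodic (Q \<union> cls x)" using pO by simp
    have "\<not> vacant (P' \<union> Q) i j"
    proof (cases "i \<in> Q \<and> j \<in> Q")
      case True then show ?thesis using s P' ij unfolding sound_def vacant_def by blast
    next
      case False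
      then consider "i \<in> cls x" | "j \<in> cls x" using ij by blast
      then show ?thesis
      proof cases
        case 1
        \<comment> \<open>Translation takes the left end to \<open>x\<close>, where \<open>R\<close>
          yields a stone inside the gap, and this stone is translated back.\<close>
        then obtain k where k: "i = x + n * k" by (rule clsE)
        have "j - n * k \<in> Q \<union> cls x" using periodicD[OF pC, of "j - n * k" j] ij by simp
        then have "\<not> vacant (P' \<union> Q) x (j - n * k)" using R[of "j - n * k"] ij k by simp
        then obtain l where "x < l" "l < j - n * k" "l \<in> P' \<union> Q"
          unfolding vacant_def by blast
        then have "i < l + n * k" "l + n * k < j" "l + n * k \<in> P' \<union> Q"
          using k pU unfolding periodic_def by auto
        then show ?thesis unfolding vacant_def by blast
      next
        case 2
        then obtain k where k: "j = x + n * k" by (rule clsE)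
        have "i - n * k \<in> Q \<union> cls x" using periodicD[OF pC, of "i - n * k" i] ij by simp
        then have "\<not> vacant (P' \<union> Q) (i - n * k) x" using L[of "i - n * k"] ij k by simp
        then obtain l where "l < x" "i - n * k < l" "l \<in> P' \<union> Q"
          unfolding vacant_def by blast
        then have "i < l + n * k" "l + n * k < j" "l + n * k \<in> P' \<union> Q"
          using k pU unfolding periodic_def by auto
        then show ?thesis unfolding vacant_def by blast
      qed
    qed
    then show ?thesis unfolding vacant_def by blast
  qed
  ultimately show ?thesis
    using s P' pO unfolding sound_def by auto
qed

text \<open>More stones of \<open>P\<close> keep every adjacency and can only break up gaps.\<close>

lemma sound_responder_insert:
  assumes "sound P Q" "y \<notin> P \<union> Q"
  shows "sound (P \<union> cls y) Q"
proof -
  have "cls y \<inter> Q = {}" using assms cls_disjoint[of Q y] unfolding sound_def by simp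
  moreover have "vacant (P \<union> Q) i j" if "vacant (P \<union> cls y \<union> Q) i j" for i j
    using that unfolding vacant_def by simp
  ultimately show ?thesis
    using assms(1) unfolding sound_def by (simp add: Int_Un_distrib2) metis
qed

text \<open>Since \<open>p + n\<close> is claimed as well, it does not precede \<open>x\<close>.
  Hence even the previous copy \<open>x - n\<close> of the new stone is not to the right of
  \<open>p\<close>.\<close>

lemma left_separated:
  assumes p: "periodic (P \<union> Q)" "p \<in> P" "p < x" "vacant (P \<union> Q) p x" "x \<notin> P \<union> Q" "p \<notin> Q"
    and i: "i \<in> Q \<union> cls x" "i < x"
  shows "i < p"
proof -
  have "x - n \<le> p"
  proof (rule ccontr)
    assume "\<not> x - n \<le> p"
    moreover have "p + n * 1 \<in> P \<union> Q" using p unfolding periodic_def by blast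
    ultimately show False using p(4) n_ge_3 unfolding vacant_def by auto
  qed
  moreover have "i \<noteq> p"
  proof
    assume "i = p"
    then have "p \<in> cls x" using i p by blast
    then show False using p cls_disjoint[OF p(1), of x] by blast
  qed
  moreover have "i \<le> p"
  proof (rule ccontr)
    assume a: "\<not> i \<le> p"
    then have "i \<notin> Q" using p(4) i unfolding vacant_def by auto
    then have "i \<in> cls x" using i by blast
    then have "i \<le> x - n" using i cls_far by blast
    with a \<open>x - n \<le> p\<close> show False by simp
  qed
  ultimately show ?thesis using p by simp
qed

lemma right_separated:
  assumes p: "periodic (P \<union> Q)" "p \<in> P" "x < p" "vacant (P \<union> Q) x p" "x \<notin> P \<union> Q" "p \<notin> Q"
    and i: "i \<in> Q \<union> cls x" "x < i"
  shows "p < i"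
proof -
  have "- i < - p"
  proof (rule left_separated[of "reflect P" "reflect Q" "- p" "- x" "- i"])
    show "vacant (reflect P \<union> reflect Q) (- p) (- x)"
      using p(4) vacant_reflect[of "P \<union> Q" "-p" "-x"] by simp
    show "- i \<in> reflect Q \<union> cls (- x)" using i reflect_cls[of x] by (metis Un_iff minus_minus reflect_iff)
  qed (use p i periodic_reflect[of "P \<union> Q"] in auto)
  then show ?thesis by simp
qed


lemma covers_reflect: "covers (reflect S) \<longleftrightarrow> covers S"
proof -
  have "covers (reflect S)" if "covers S" for S
    unfolding covers_def reflect_iff
  proof
    fix i
    from that have "- i - 1 \<in> S \<or> - i \<in> S \<or> - i + 1 \<in> S" unfolding covers_def by blast
    moreover have "- (i - 1) = - i + 1" "- (i + 1) = - i - 1" by simp_all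
    ultimately show "- (i - 1) \<in> S \<or> - i \<in> S \<or> - (i + 1) \<in> S" by metis
  qed
  from this[of S] this[of "reflect S"] show ?thesis by auto
qed

text \<open>By soundness the gap around an undominated vertex has an end in \<open>P\<close>;
  \<open>d\<close> points from there into the gap. A third cell in \<open>P\<close> would leave a
  gap of length 2, which its two ends dominate.\<close>

lemma uncovered_end:
  assumes s: "sound P Q" and nc: "\<not> covers P"
  obtains i d where "d = 1 \<or> d = - 1" "i \<in> P" "i + d \<notin> P \<union> Q" "i + 2 * d \<notin> P \<union> Q" "i + 3 * d \<notin> P"
proof -
  obtain v where v: "v - 1 \<notin> P" "v \<notin> P" "v + 1 \<notin> P" using nc unfolding covers_def by blast
  have vU: "v \<notin> P \<union> Q" using s v unfolding sound_def by blast
  have U: "periodic (P \<union> Q)" "P \<union> Q \<noteq> {}" using s unfolding sound_def by auto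
  obtain i where i: "i \<in> P \<union> Q" "i < v" "vacant (P \<union> Q) i v" using nearest_left[OF U vU] .
  obtain j where j: "j \<in> P \<union> Q" "v < j" "vacant (P \<union> Q) v j" using nearest_right[OF U vU] .
  have ij: "vacant (P \<union> Q) i j"
    using i j vU unfolding vacant_def by (metis linorder_neqE)
  have "i \<in> P \<or> j \<in> P" using s i j ij unfolding sound_def by force
  then show thesis
  proof
    assume "i \<in> P"
    then have "i \<noteq> v - 1" using v by auto
    then have iv: "i + 2 \<le> v" using i by linarith
    have "i + 1 \<notin> P \<union> Q" "i + 2 \<notin> P \<union> Q" using ij iv j unfolding vacant_def by simp_all
    moreover have "i + 3 \<notin> P"
    proof (cases "i + 2 = v")
      case True
      then have "i + 3 = v + 1" by simp
      then show ?thesis using v by metis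
    next
      case False
      then show ?thesis using ij iv j unfolding vacant_def by simp
    qed
    ultimately show thesis using that[of 1 i] \<open>i \<in> P\<close> by simp
  next
    assume "j \<in> P"
    then have "j \<noteq> v + 1" using v by auto
    then have iv: "v + 2 \<le> j" using j by linarith
    have "j - 1 \<notin> P \<union> Q" "j - 2 \<notin> P \<union> Q" using ij iv i unfolding vacant_def by simp_all
    moreover have "j - 3 \<notin> P"
    proof (cases "j - 2 = v")
      case True
      then have "j - 3 = v - 1" by simp
      then show ?thesis using v by simp
    next
      case False
      then show ?thesis using ij iv i unfolding vacant_def by simp
    qed
    ultimately show thesis using that[of "- 1" j] \<open>j \<in> P\<close> by simp
  qed
qed

text \<open>A responder with a turn to spare needs no source beforehand, since one can be
  made.\<close>

lemma free_move:
  assumes s: "sound P Q" and nc: "\<not> covers P"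
  obtains y where "y \<notin> P \<union> Q" "sound (P \<union> cls y) Q" "source (P \<union> cls y) Q"
proof -
  obtain i d where d: "d = 1 \<or> d = - 1" and i: "i \<in> P" "i + d \<notin> P \<union> Q" "i + 2 * d \<notin> P \<union> Q"
    using uncovered_end[OF s nc] .
  \<comment> \<open>Leaving a gap of length 1 behind creates a source.\<close>
  define y where "y = i + 2 * d"
  define a b where "a = min i y" and "b = max i y"
  have ab: "a \<in> P \<union> cls y" "b \<in> P \<union> cls y" "b = a + 2" "a + 1 = i + d"
    using i d unfolding a_def b_def y_def by auto
  have "i + d \<notin> cls y" using cls_near[of "i + d" y] d n_ge_3 unfolding y_def by auto
  then have "vacant (P \<union> cls y \<union> Q) a b"
    using i ab unfolding vacant_def by (smt (verit) Un_iff)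
  moreover have "a < b" "(b - a) mod 3 \<noteq> 1" using ab by simp_all
  ultimately have "source (P \<union> cls y) Q" unfolding source_def using ab(1,2) by blast
  moreover have "y \<notin> P \<union> Q" using i unfolding y_def by blast
  ultimately show thesis using that sound_responder_insert[OF s] by blast
qed

text \<open>\<open>Q\<close> still lacks domination both next to the end found by
  \<open>uncovered_end\<close> and at the source. A single stone would have to repair both, which
  the local shapes of the two places forbid.\<close>

lemma mover_not_covering:
  assumes s: "sound P Q" and so: "source P Q" and nc: "\<not> covers P" and x: "x \<notin> P \<union> Q"
  shows "\<not> covers (Q \<union> cls x)"
proof
  assume cov: "covers (Q \<union> cls x)"
  have per: "periodic P" "periodic Q" and dj: "P \<inter> Q = {}" using s unfolding sound_def by auto
  have xP: "k \<notin> cls x" if "k \<in> P \<union> Q" for k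
    using cls_disjoint[of "P \<union> Q" x] per x that by auto
  have hit: "k - 1 \<in> cls x \<or> k \<in> cls x \<or> k + 1 \<in> cls x"
    if "k - 1 \<notin> Q" "k \<notin> Q" "k + 1 \<notin> Q" for k
    using cov that unfolding covers_def by blast
  obtain i0 d where d: "d = 1 \<or> d = - 1"
    and i0: "i0 \<in> P" "i0 + d \<notin> P \<union> Q" "i0 + 2 * d \<notin> P \<union> Q" "i0 + 3 * d \<notin> P"
    using uncovered_end[OF s nc] .
  \<comment> \<open>\<open>i0 + d\<close> has no stone of \<open>Q\<close> on it or beside it, so
    the finishing stone lies on one of the two free cells after \<open>i0\<close>; periodicity
    extends this to each of its copies.\<close>
  have near: "\<exists>i\<in>P. (u = i + d \<or> u = i + 2 * d) \<and> i + d \<notin> P \<union> Q \<and> i + 2 * d \<notin> P \<union> Q \<and> i + 3 * d \<notin> P"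
    if u: "u \<in> cls x" for u
  proof -
    have "i0 + d \<in> cls x \<or> i0 + 2 * d \<in> cls x"
    proof -
      have "i0 \<notin> Q" "i0 \<notin> cls x" using i0 dj xP[of i0] by auto
      then show ?thesis using hit[of "i0 + d"] i0 d by (elim disjE) (auto simp: algebra_simps)
    qed
    then obtain w where w: "w \<in> cls x" "w = i0 + d \<or> w = i0 + 2 * d" by blast
    obtain k where k: "u = w + n * k" using cls_cong[OF u w(1)] by (rule clsE)
    define i where "i = i0 + n * k"
    have "i + e \<in> P \<longleftrightarrow> i0 + e \<in> P" "i + e \<in> Q \<longleftrightarrow> i0 + e \<in> Q" for e
      using periodic_shift[OF per(1), of "i0 + e" k] periodic_shift[OF per(2), of "i0 + e" k]
      unfolding i_def by (simp_all add: algebra_simps)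
    from this[of 0] this[of d] this[of "2 * d"] this[of "3 * d"] show ?thesis
      using i0 w k unfolding i_def by (intro bexI[of _ "i0 + n * k"]) auto
  qed
  from so show False unfolding source_def
  proof (elim disjE bexE conjE)
    fix p q assume pq: "p \<in> P" "q \<in> P" "p < q" "vacant (P \<union> Q) p q" "(q - p) mod 3 \<noteq> 1"
    have "q \<noteq> p + 1" using pq(5) by auto
    then have pq2: "p + 2 \<le> q" using pq(3) by linarith
    have inQ: "k \<notin> Q" if "p \<le> k" "k \<le> q" for k
      using pq that dj unfolding vacant_def by (metis UnCI disjoint_iff order_le_less)
    \<comment> \<open>Neither \<open>p + 1\<close> nor \<open>q - 1\<close> is dominated by
      \<open>Q\<close>, so the finishing stone has to reach both. The gap fits into one period, so
      the same copy does it, and the gap has at most 3 vertices.\<close>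
    have "p + 1 \<in> cls x \<or> p + 2 \<in> cls x"
      using hit[of "p + 1"] inQ[of p] inQ[of "p + 1"] inQ[of "p + 2"] pq2 xP[of p] pq(1) by (auto simp: algebra_simps)
    then obtain u where u: "u \<in> cls x" "u = p + 1 \<or> u = p + 2" by blast
    have "q - 1 \<in> cls x \<or> q - 2 \<in> cls x"
      using hit[of "q - 1"] inQ[of q] inQ[of "q - 1"] inQ[of "q - 2"] pq2 xP[of q] pq(2) by (auto simp: algebra_simps)
    then obtain v where v: "v \<in> cls x" "v = q - 1 \<or> v = q - 2" by blast
    have uq: "u \<noteq> q" "v \<noteq> p" using xP u v pq by auto
    have "q \<le> p + n"
    proof (rule ccontr)
      assume "\<not> q \<le> p + n"
      moreover have "p + n * 1 \<in> P" using periodic_shift[OF per(1)] pq(1) by blast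
      ultimately show False using pq(4) n_ge_3 unfolding vacant_def by auto
    qed
    moreover have "v \<in> cls u"
      using cls_cong u v by blast
    ultimately have "u = v" using cls_near[of v u] u v uq pq2 by force
    obtain i where i: "i \<in> P" "u = i + d \<or> u = i + 2 * d" "i + d \<notin> P \<union> Q" "i + 2 * d \<notin> P \<union> Q" "i + 3 * d \<notin> P"
      using near[OF u(1)] by blast
    have "q = p + 2 \<or> q = p + 3 \<or> q = p + 4" using \<open>u = v\<close> u v uq by auto
    \<comment> \<open>Length 3 is excluded by the residue. Lengths 1 and 2 are excluded by
      \<open>near\<close>, where no stone of \<open>P\<close> occurs among the next three
      cells.\<close>
    then have "q = p + 2 \<or> q = p + 3" using pq(5) by auto
    moreover have "i \<le> p \<or> q \<le> i"
      using pq(4) i(1) unfolding vacant_def by force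
    moreover have "i + d \<noteq> p" "i + d \<noteq> q" "i + 2 * d \<noteq> p" "i + 2 * d \<noteq> q" "i + 3 * d \<noteq> p" "i + 3 * d \<noteq> q"
      using i pq(1,2) by blast+
    ultimately show False
      using d i(2) u(2) v(2) \<open>u = v\<close> by (smt (verit))
  next
    fix g assume g: "g \<in> P" "g - 1 \<notin> P \<union> Q" "g + 1 \<notin> P \<union> Q" "g - 2 \<in> Q" "g + 2 \<in> Q"
    \<comment> \<open>\<open>Q\<close> must still dominate \<open>g\<close>, but on either side of
      \<open>g\<close> there is a single free cell, whereas \<open>near\<close> requires
      two.\<close>
    have "g - 1 \<in> cls x \<or> g + 1 \<in> cls x" using hit[of g] g dj xP[of g] by blast
    then obtain u where u: "u \<in> cls x" "u = g - 1 \<or> u = g + 1" by blast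
    obtain i where i: "i \<in> P" "u = i + d \<or> u = i + 2 * d" "i + d \<notin> P \<union> Q" "i + 2 * d \<notin> P \<union> Q"
      using near[OF u(1)] by blast
    have "i \<noteq> g - 2" "i \<noteq> g + 2" "i + d \<noteq> g" "i + d \<noteq> g - 2" "i + d \<noteq> g + 2"
      "i + 2 * d \<noteq> g" "i + 2 * d \<noteq> g - 2" "i + 2 * d \<noteq> g + 2"
      using g dj i by (metis UnCI disjoint_iff)+
    then show False using d u(2) i(2) by (smt (verit))
  qed
qed

text \<open>Adjacent new stones cannot straddle a claimed end of a gap, and the free cells beside an
  isolated stone have no free neighbour. So a source is disturbed only from inside its gap; the
  second alternative is this case, translated to the copy that contains \<open>x\<close>.\<close>

lemma source_insert:
  assumes s: "sound P Q" and so: "source P Q" and x: "x \<notin> P \<union> Q"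
    and y: "y = x - 1 \<or> y = x + 1" "y \<notin> P \<union> Q"
  obtains "source (P \<union> cls y) (Q \<union> cls x)"
  | p q where "p \<in> P" "q \<in> P" "p < x" "x < q" "vacant (P \<union> Q) p q" "(q - p) mod 3 \<noteq> 1"
proof -
  have per: "periodic P" "periodic Q" "periodic (P \<union> Q)" using s unfolding sound_def by auto
  have xU: "k \<notin> cls x" and yU: "k \<notin> cls y" if "k \<in> P \<union> Q" for k
    using cls_disjoint[of "P \<union> Q" x] cls_disjoint[of "P \<union> Q" y] per x y that by auto
  have yx: "k - (y - x) \<in> cls x" if "k \<in> cls y" for k using that unfolding cls_def by simp
  have xy: "k + (y - x) \<in> cls y" if "k \<in> cls x" for k using that unfolding cls_def by simp
  from so show thesis unfolding source_def
  proof (elim disjE bexE conjE)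
    fix p q assume pq: "p \<in> P" "q \<in> P" "p < q" "vacant (P \<union> Q) p q" "(q - p) mod 3 \<noteq> 1"
    show thesis
    proof (cases "\<exists>u\<in>cls x. p < u \<and> u < q")
      case True
      then obtain k where k: "p < x + n * k" "x + n * k < q" by (auto elim: clsE)
      have "p - n * k \<in> P" "q - n * k \<in> P"
        using pq periodic_shift[OF per(1), of _ "- k"] by auto
      moreover have "vacant (P \<union> Q) (p - n * k) (q - n * k)"
        unfolding vacant_def
      proof (intro allI impI)
        fix l assume "p - n * k < l" "l < q - n * k"
        then have "l + n * k \<notin> P \<union> Q" using pq(4) unfolding vacant_def by simp
        then show "l \<notin> P \<union> Q" using periodic_shift[OF per(3)] by blast
      qed
      ultimately show thesis using that(2)[of "p - n * k" "q - n * k"] k pq by simp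
    next
      case False
      have "vacant ((P \<union> cls y) \<union> (Q \<union> cls x)) p q"
        unfolding vacant_def
      proof (intro allI impI)
        fix k assume k: "p < k" "k < q"
        have "k \<notin> cls y"
        proof
          assume a: "k \<in> cls y"
          have "k - (y - x) = p \<or> k - (y - x) = q" using False yx[OF a] k y(1) by force
          then show False using yx[OF a] xU pq by auto
        qed
        then show "k \<notin> (P \<union> cls y) \<union> (Q \<union> cls x)"
          using False k pq(4) unfolding vacant_def by auto
      qed
      then have "source (P \<union> cls y) (Q \<union> cls x)" unfolding source_def using pq by blast
      then show thesis by (rule that(1))
    qed
  next
    fix g assume g: "g \<in> P" "g - 1 \<notin> P \<union> Q" "g + 1 \<notin> P \<union> Q" "g - 2 \<in> Q" "g + 2 \<in> Q"
    have "k \<notin> cls x \<and> k \<notin> cls y" if k: "k = g - 1 \<or> k = g + 1" for k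
    proof -
      have "k - (y - x) \<in> {g - 2, g, g + 2}" "k + (y - x) \<in> {g - 2, g, g + 2}" using k y(1) by auto
      then have "k - (y - x) \<in> P \<union> Q" "k + (y - x) \<in> P \<union> Q" using g by auto
      then show ?thesis using xy[of k] yx[of k] xU yU by blast
    qed
    then have "source (P \<union> cls y) (Q \<union> cls x)" unfolding source_def using g by blast
    then show thesis by (rule that(1))
  qed
qed


section \<open>The responder's answer\<close>

text \<open>To be read with \<open>Q\<close> to move; \<open>P\<close> can return to such a position
  until \<open>P\<close> dominates.\<close>

definition winning :: "int set \<Rightarrow> int set \<Rightarrow> bool" where
  "winning P Q \<longleftrightarrow> sound P Q \<and> source P Q"

lemma winning_reflectI: "winning P Q \<Longrightarrow> winning (reflect P) (reflect Q)"
  unfolding winning_def using sound_reflectI source_reflectI by blast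

text \<open>\<open>y\<close> may already belong to \<open>P\<close>, which serves the moves that
  leave the responder a turn to spare. On each side \<open>x\<close> is shielded by a claimed
  neighbour or by a stone of \<open>P\<close> ending the gap, so no gap between two stones of
  \<open>Q\<close> arises.\<close>

lemma sound_answer:
  assumes s: "sound P Q" and x: "x \<notin> P \<union> Q"
    and y: "y \<in> {x - 1, x + 1}" "y \<notin> Q"
    and l: "x - 1 \<in> P \<union> Q \<union> {y} \<or> (\<exists>p\<in>P. p < x \<and> vacant (P \<union> Q) p x)"
    and r: "x + 1 \<in> P \<union> Q \<union> {y} \<or> (\<exists>p\<in>P. x < p \<and> vacant (P \<union> Q) x p)"
  shows "sound (P \<union> cls y) (Q \<union> cls x)"
proof -
  have per: "periodic P" "periodic Q" "periodic (P \<union> Q)" and dj: "P \<inter> Q = {}"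
    using s unfolding sound_def by auto
  show ?thesis
  proof (rule sound_insert[OF s])
    show "(P \<union> cls y) \<inter> Q = {}" using dj y cls_disjoint[OF per(2), of y] by blast
    have "x \<notin> cls y" using cls_near[of x y] y n_ge_3 by auto
    then show "x \<notin> P \<union> cls y \<union> Q" using x by blast
    show "x - 1 \<in> P \<union> cls y \<or> x + 1 \<in> P \<union> cls y" using y cls_self[of y] by auto
  next
    fix i assume i: "i \<in> Q \<union> cls x" "i + 1 < x"
    from l show "\<not> vacant (P \<union> cls y \<union> Q) i x"
    proof (elim disjE bexE conjE)
      assume "x - 1 \<in> P \<union> Q \<union> {y}"
      then have "x - 1 \<in> P \<union> cls y \<union> Q" by auto
      moreover have "i < x - 1" "x - 1 < x" using i by auto
      ultimately show ?thesis unfolding vacant_def by blast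
    next
      fix p assume p: "p \<in> P" "p < x" "vacant (P \<union> Q) p x"
      then have "i < p" using left_separated[OF per(3), of p x i] x i dj by auto
      then show ?thesis using p unfolding vacant_def by blast
    qed
  next
    fix j assume i: "j \<in> Q \<union> cls x" "x + 1 < j"
    from r show "\<not> vacant (P \<union> cls y \<union> Q) x j"
    proof (elim disjE bexE conjE)
      assume "x + 1 \<in> P \<union> Q \<union> {y}"
      then have "x + 1 \<in> P \<union> cls y \<union> Q" by auto
      moreover have "x + 1 < j" "x < x + 1" using i by auto
      ultimately show ?thesis unfolding vacant_def by blast
    next
      fix p assume p: "p \<in> P" "x < p" "vacant (P \<union> Q) x p"
      then have "p < j" using right_separated[OF per(3), of p x j] x i dj by auto
      then show ?thesis using p unfolding vacant_def by blast
    qed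
  qed (use per in auto)
qed

lemma cls_absorb: "periodic P \<Longrightarrow> y \<in> P \<Longrightarrow> P \<union> cls y = P"
  unfolding cls_def using periodicD by blast

text \<open>If the right end \<open>j\<close> is in \<open>P\<close>, the answer goes to the side
  that leaves a source; if it is in \<open>Q\<close>, the answer must shield \<open>x\<close> from
  \<open>j\<close>. Where \<open>x\<close> is shielded and adjacent to \<open>P\<close> already, the
  spare turn creates a new source.\<close>

lemma answer_left:
  assumes w: "winning P Q" and nc: "\<not> covers P" and x: "x \<notin> P \<union> Q"
    and i: "i \<in> P" "i < x" "vacant (P \<union> Q) i x"
    and j: "j \<in> P \<union> Q" "x < j" "vacant (P \<union> Q) x j"
  shows "\<exists>y. y \<notin> P \<union> Q \<union> cls x \<and> winning (P \<union> cls y) (Q \<union> cls x)"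
proof -
  have s: "sound P Q" and so: "source P Q" using w unfolding winning_def by auto
  have per: "periodic P" "periodic Q" "periodic (P \<union> Q)" and dj: "P \<inter> Q = {}"
    using s unfolding sound_def by auto
  have fresh: "y \<notin> cls x" if "y = x - 1 \<or> y = x + 1" for y
    using cls_near[of y x] that n_ge_3 by auto
  have free: ?thesis if "sound P (Q \<union> cls x)"
    using free_move[OF that nc] unfolding winning_def by blast
  have unique: "p = i \<and> q = j"
    if "p \<in> P" "q \<in> P" "p < x" "x < q" "vacant (P \<union> Q) p q" for p q
  proof -
    have "\<not> p < i" "\<not> i < p" "\<not> j < q" "\<not> q < j"
      using that i j unfolding vacant_def by (meson UnCI less_trans)+
    then show ?thesis by simp
  qed
  have leftok: "\<exists>p\<in>P. p < x \<and> vacant (P \<union> Q) p x" using i by blast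
  \<comment> \<open>If \<open>x\<close> splits the source, the gap from \<open>x + 1\<close> to
    \<open>j\<close> has to take over its role.\<close>
  have right: ?thesis if "x + 1 \<notin> P \<union> Q" "j \<in> P \<Longrightarrow> (j - i) mod 3 \<noteq> 1 \<Longrightarrow> (j - (x + 1)) mod 3 \<noteq> 1"
  proof -
    have snd: "sound (P \<union> cls (x + 1)) (Q \<union> cls x)"
      by (rule sound_answer[OF s x]) (use that leftok in auto)
    have "source (P \<union> cls (x + 1)) (Q \<union> cls x)"
    proof (rule source_insert[OF s so x _ that(1)])
      fix p q assume pq: "p \<in> P" "q \<in> P" "p < x" "x < q" "vacant (P \<union> Q) p q" "(q - p) mod 3 \<noteq> 1"
      then have j': "j \<in> P" "(j - (x + 1)) mod 3 \<noteq> 1" using unique that(2) by blast+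
      have "j \<noteq> x + 1" using that(1) j' by auto
      then have "x + 1 < j" using j by simp
      moreover have "vacant (P \<union> cls (x + 1) \<union> (Q \<union> cls x)) (x + 1) j"
        unfolding vacant_def
      proof (intro allI impI)
        fix k assume k: "x + 1 < k" "k < j"
        \<comment> \<open>The gap fits into one period, so no further copy of the two new stones
          falls inside it.\<close>
        have "j \<le> i + n"
        proof (rule ccontr)
          assume "\<not> j \<le> i + n"
          moreover have "i + n * 1 \<in> P" using periodic_shift[OF per(1)] i(1) by blast
          moreover have "i + n \<noteq> x" using x calculation(2) by auto
          ultimately show False using i j n_ge_3 unfolding vacant_def
            by (smt (verit) Un_iff mult.right_neutral)
        qed
        then have "k \<notin> cls x" "k \<notin> cls (x + 1)"
          using cls_near[of k x] cls_near[of k "x + 1"] k i by auto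
        then show "k \<notin> P \<union> cls (x + 1) \<union> (Q \<union> cls x)" using j k unfolding vacant_def by auto
      qed
      ultimately show ?thesis unfolding source_def using j' by (metis UnCI cls_self)
    qed auto
    then show ?thesis using snd that fresh[of "x + 1"] unfolding winning_def by blast
  qed
  show ?thesis
  proof (cases "j \<in> P")
    case True
    have rightok: "\<exists>p\<in>P. x < p \<and> vacant (P \<union> Q) x p" using j True by blast
    show ?thesis
    proof (cases "x - 1 \<in> P \<or> x + 1 \<in> P")
      case True
      then obtain y where y: "y = x - 1 \<or> y = x + 1" "y \<in> P" by blast
      have "sound (P \<union> cls y) (Q \<union> cls x)"
        by (rule sound_answer[OF s x]) (use y dj leftok rightok in auto)
      then show ?thesis using free cls_absorb[OF per(1) y(2)] by simp
    next
      case False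
      have ends: "x - 1 \<noteq> i" "x + 1 \<noteq> j" using False i \<open>j \<in> P\<close> by auto
      then have e: "x - 1 \<notin> P \<union> Q" "x + 1 \<notin> P \<union> Q"
        using i j unfolding vacant_def by auto
      show ?thesis
      proof (cases "(j - i) mod 3 \<noteq> 1 \<longrightarrow> (j - (x + 1)) mod 3 \<noteq> 1")
        case True then show ?thesis using right e by blast
      next
        case F: False
        \<comment> \<open>The end distances of the two candidate gaps add up to
          \<open>j - i - 2\<close>. If both were 1 modulo 3, so would be \<open>j - i\<close>; hence
          a source is kept on one of the sides.\<close>
        have "(x - 1 - i) mod 3 \<noteq> 1" using F by presburger
        moreover have "sound (P \<union> cls (x - 1)) (Q \<union> cls x)"
          by (rule sound_answer[OF s x]) (use e rightok in auto)
        moreover have "vacant (P \<union> cls (x - 1) \<union> (Q \<union> cls x)) i (x - 1)"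
          unfolding vacant_def
        proof (intro allI impI)
          fix k assume k: "i < k" "k < x - 1"
          have "x \<le> i + n"
          proof (rule ccontr)
            assume "\<not> x \<le> i + n"
            moreover have "i + n * 1 \<in> P" using periodic_shift[OF per(1)] i(1) by blast
            ultimately show False using i n_ge_3 unfolding vacant_def by auto
          qed
          then have "k \<notin> cls x" "k \<notin> cls (x - 1)"
            using cls_near[of k x] cls_near[of k "x - 1"] k by auto
          then show "k \<notin> P \<union> cls (x - 1) \<union> (Q \<union> cls x)" using i k unfolding vacant_def by auto
        qed
        moreover have "i < x - 1" using i ends by simp
        ultimately have "winning (P \<union> cls (x - 1)) (Q \<union> cls x)"
          unfolding winning_def source_def using i(1) by (metis UnCI cls_self)
        then show ?thesis using e fresh[of "x - 1"] by blast
      qed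
    qed
  next
    case False
    then have jQ: "j \<in> Q" using j by blast
    show ?thesis
    proof (cases "x + 1 \<in> P \<union> Q")
      case False
      then show ?thesis using right \<open>j \<notin> P\<close> by blast
    next
      case x1: True
      show ?thesis
      proof (cases "x - 1 \<in> P \<union> Q")
        case True
        then have "x - 1 = i" using i unfolding vacant_def by (metis less_irrefl linorder_neqE zle_diff1_eq le_less diff_add_cancel zless_add1_eq)
        then have y: "x - 1 \<in> P" using i by simp
        have "sound (P \<union> cls (x - 1)) (Q \<union> cls x)"
          by (rule sound_answer[OF s x]) (use y dj leftok x1 in auto)
        then show ?thesis using free cls_absorb[OF per(1) y] by simp
      next
        case e: False
        have "sound (P \<union> cls (x - 1)) (Q \<union> cls x)"
          by (rule sound_answer[OF s x]) (use e x1 in auto)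
        \<comment> \<open>The gap around \<open>x\<close> ends in \<open>Q\<close>, so the source
          lies elsewhere and survives.\<close>
        moreover have "source (P \<union> cls (x - 1)) (Q \<union> cls x)"
          by (rule source_insert[OF s so x _ e]) (use unique \<open>j \<notin> P\<close> in auto)
        ultimately show ?thesis using e fresh[of "x - 1"] unfolding winning_def by blast
      qed
    qed
  qed
qed

text \<open>Soundness forbids a gap with both ends in \<open>Q\<close>; reflection turns an end in
  \<open>P\<close> into the left one.\<close>

lemma winning_answer:
  assumes w: "winning P Q" and nc: "\<not> covers P" and x: "x \<notin> P \<union> Q"
  shows "\<exists>y. y \<notin> P \<union> Q \<union> cls x \<and> winning (P \<union> cls y) (Q \<union> cls x)"
proof -
  have U: "periodic (P \<union> Q)" "P \<union> Q \<noteq> {}" using w unfolding winning_def sound_def by auto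
  obtain i where i: "i \<in> P \<union> Q" "i < x" "vacant (P \<union> Q) i x" using nearest_left[OF U x] .
  obtain j where j: "j \<in> P \<union> Q" "x < j" "vacant (P \<union> Q) x j" using nearest_right[OF U x] .
  have "vacant (P \<union> Q) i j" using i j x unfolding vacant_def by (metis linorder_neqE)
  then have "i \<in> P \<or> j \<in> P" using w i j unfolding winning_def sound_def by force
  then show ?thesis
  proof
    assume "i \<in> P"
    then show ?thesis using answer_left[OF w nc x] i j by blast
  next
    assume "j \<in> P"
    have "\<exists>y. y \<notin> reflect P \<union> reflect Q \<union> cls (- x) \<and>
        winning (reflect P \<union> cls y) (reflect Q \<union> cls (- x))"
    proof (rule answer_left[of _ _ "- x" "- j" "- i"])
      show "winning (reflect P) (reflect Q)" by (rule winning_reflectI[OF w])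
      show "\<not> covers (reflect P)" using nc covers_reflect by simp
      show "vacant (reflect P \<union> reflect Q) (- j) (- x)" "vacant (reflect P \<union> reflect Q) (- x) (- i)"
        using i j vacant_reflect[of "P \<union> Q"] by simp_all
    qed (use x i j \<open>j \<in> P\<close> in auto)
    then obtain y where y: "y \<notin> reflect P \<union> reflect Q \<union> cls (- x)"
        "winning (reflect P \<union> cls y) (reflect Q \<union> cls (- x))" by blast
    have "winning (P \<union> cls (- y)) (Q \<union> cls x)" using winning_reflectI[OF y(2)] by simp
    moreover have "- y \<notin> cls x" using y(1) reflect_cls[of x] reflect_iff[of y "cls x"] by blast
    ultimately show ?thesis using y(1) by auto
  qed
qed

section \<open>Bob avoids losing\<close>

text \<open>
  In \<open>bob_draws A B\<close> it is Alice's turn, in \<open>bob_moves A B\<close> it is Bob's. A greatest fixed point suffices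
  because plays are finite.
\<close>

coinductive bob_draws :: "int set \<Rightarrow> int set \<Rightarrow> bool" where
  "(\<And>y. y \<notin> A \<union> B \<Longrightarrow> \<not> covers (A \<union> cls y) \<and>
     (A \<union> cls y \<union> B = UNIV \<or>
      (\<exists>x. x \<notin> A \<union> cls y \<union> B \<and> (covers (B \<union> cls x) \<or> bob_draws (A \<union> cls y) (B \<union> cls x)))))
   \<Longrightarrow> bob_draws A B"

definition bob_moves :: "int set \<Rightarrow> int set \<Rightarrow> bool" where
  "bob_moves A B \<longleftrightarrow> A \<union> B = UNIV \<or>
     (\<exists>x. x \<notin> A \<union> B \<and> (covers (B \<union> cls x) \<or> bob_draws A (B \<union> cls x)))"

lemma not_coversI: "k \<notin> S \<Longrightarrow> k + 1 \<notin> S \<Longrightarrow> k + 2 \<notin> S \<Longrightarrow> \<not> covers S"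
  unfolding covers_def not_all by (rule exI[of _ "k + 1"]) (simp add: add.assoc)

definition position :: "int set \<Rightarrow> int set \<Rightarrow> bool" where
  "position A B \<longleftrightarrow> periodic A \<and> periodic B \<and> A \<inter> B = {}"

lemma bob_drawsI:
  assumes "\<And>y. y \<notin> A \<union> B \<Longrightarrow> \<not> covers (A \<union> cls y)"
    and "\<And>y. y \<notin> A \<union> B \<Longrightarrow> bob_moves (A \<union> cls y) B"
  shows "bob_draws A B"
  using assms unfolding bob_moves_def by (intro bob_draws.intros conjI)

lemma bob_movesI:
  "x \<notin> A \<union> B \<Longrightarrow> covers (B \<union> cls x) \<or> bob_draws A (B \<union> cls x) \<Longrightarrow> bob_moves A B"
  unfolding bob_moves_def by blast

lemma position_alice: "position A B \<Longrightarrow> y \<notin> A \<union> B \<Longrightarrow> position (A \<union> cls y) B"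
  unfolding position_def using cls_disjoint[of B y] by auto

lemma position_bob: "position A B \<Longrightarrow> x \<notin> A \<union> B \<Longrightarrow> position A (B \<union> cls x)"
  unfolding position_def using cls_disjoint[of A x] by auto

lemma cls_eq: "i \<in> cls j \<Longrightarrow> cls i = cls j"
proof -
  assume i: "i \<in> cls j"
  then have j: "j \<in> cls i" by (rule cls_cong[OF cls_self])
  show "cls i = cls j" using cls_cong[OF _ i] cls_cong[OF _ j] by blast
qed

section \<open>Threats to claim three consecutive vertices\<close>

text \<open>Alice can never dominate \<open>t + 1\<close>, so any reply of Bob will do.\<close>

lemma bob_draws_triple:
  assumes "position A B" "t \<in> B" "t + 1 \<in> B" "t + 2 \<in> B"
  shows "bob_draws A B"
  using assms
proof (coinduction arbitrary: A B rule: bob_draws.coinduct)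
  case bob_draws
  have "\<not> covers (A \<union> cls y) \<and>
     (A \<union> cls y \<union> B = UNIV \<or> (\<exists>x. x \<notin> A \<union> cls y \<union> B \<and>
        (covers (B \<union> cls x) \<or>
         ((position (A \<union> cls y) (B \<union> cls x) \<and> t \<in> B \<union> cls x \<and> t + 1 \<in> B \<union> cls x \<and> t + 2 \<in> B \<union> cls x)
           \<or> bob_draws (A \<union> cls y) (B \<union> cls x)))))"
    if y: "y \<notin> A \<union> B" for y
  proof -
    have p: "position (A \<union> cls y) B" using position_alice bob_draws(1) y by blast
    have "k \<notin> A \<union> cls y" if "k \<in> B" for k using p that unfolding position_def by blast
    then have "\<not> covers (A \<union> cls y)" using bob_draws by (intro not_coversI[of t]) blast+
    moreover have "position (A \<union> cls y) (B \<union> cls x)" if "x \<notin> A \<union> cls y \<union> B" for x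
      using position_bob[OF p that] .
    ultimately show ?thesis using bob_draws by blast
  qed
  then show ?case by (rule_tac exI[of _ A], rule_tac exI[of _ B]) (intro conjI refl allI impI, simp_all)
qed

lemma bob_draws_winning:
  assumes "winning B A" "\<not> covers B"
  shows "bob_draws A B"
  using assms
proof (coinduction arbitrary: A B rule: bob_draws.coinduct)
  case bob_draws
  have "\<not> covers (A \<union> cls y) \<and>
     (A \<union> cls y \<union> B = UNIV \<or> (\<exists>x. x \<notin> A \<union> cls y \<union> B \<and> (covers (B \<union> cls x) \<or>
       (winning (B \<union> cls x) (A \<union> cls y) \<and> \<not> covers (B \<union> cls x) \<or> bob_draws (A \<union> cls y) (B \<union> cls x)))))"
    if y: "y \<notin> A \<union> B" for y
  proof -
    have "y \<notin> B \<union> A" using y by blast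
    then have "\<not> covers (A \<union> cls y)"
      using mover_not_covering[of B A y] bob_draws unfolding winning_def by blast
    moreover obtain x where "x \<notin> B \<union> A \<union> cls y" "winning (B \<union> cls x) (A \<union> cls y)"
      using winning_answer[of B A y] bob_draws \<open>y \<notin> B \<union> A\<close> by blast
    ultimately show ?thesis by blast
  qed
  then show ?case by (rule_tac exI[of _ A], rule_tac exI[of _ B]) (intro conjI refl allI impI, simp_all)
qed

text \<open>Bob is the responder with a turn to spare, which he spends on a source.\<close>

lemma bob_moves_sound:
  assumes "sound B A" "\<not> covers B"
  shows "bob_moves A B"
proof -
  obtain x where "x \<notin> B \<union> A" "winning (B \<union> cls x) A"
    using free_move[OF assms] unfolding winning_def by blast
  then show ?thesis
    using bob_draws_winning by (intro bob_movesI[of x]) auto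
qed

text \<open>Unless Alice plays \<open>q + 1\<close>, Bob completes three consecutive vertices there,
  so only the forced reply has to be examined.\<close>

lemma bob_draws_threat:
  assumes p: "position A B" and q: "q \<in> B" "q + 2 \<in> B" "q + 1 \<notin> A \<union> B"
    and nc: "\<not> covers (A \<union> cls (q + 1))" and m: "bob_moves (A \<union> cls (q + 1)) B"
  shows "bob_draws A B"
proof (rule bob_drawsI)
  fix y assume y: "y \<notin> A \<union> B"
  have p': "position (A \<union> cls y) B" using position_alice[OF p y] .
  have "\<not> covers (A \<union> cls y) \<and> bob_moves (A \<union> cls y) B"
  proof (cases "q + 1 \<in> cls y")
    case True
    then show ?thesis using nc m cls_eq by simp
  next
    case False
    have "q \<notin> A \<union> cls y" "q + 2 \<notin> A \<union> cls y" using p' q unfolding position_def by blast+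
    moreover have x: "q + 1 \<notin> A \<union> cls y \<union> B" using q False by blast
    ultimately have "\<not> covers (A \<union> cls y)"
      using q False by (intro not_coversI[of q]) blast+
    moreover have "bob_draws (A \<union> cls y) (B \<union> cls (q + 1))"
      by (rule bob_draws_triple[of _ _ q]) (use q position_bob[OF p' x] in auto)
    ultimately show ?thesis by (simp add: bob_movesI[OF x])
  qed
  then show "\<not> covers (A \<union> cls y)" "bob_moves (A \<union> cls y) B" by auto
qed

text \<open>Bob completes a triple at \<open>q\<close> or at \<open>q + 3\<close>. These are
  different vertices because \<open>n \<ge> 4\<close>, so Alice cannot block both.\<close>

lemma bob_draws_double_threat:
  assumes p: "position A B" and q: "q + 1 \<in> B" "q + 2 \<in> B" "q \<notin> A \<union> B" "q + 3 \<notin> A \<union> B"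
    and n: "n \<ge> 4"
  shows "bob_draws A B"
proof (rule bob_drawsI)
  fix y assume y: "y \<notin> A \<union> B"
  have p': "position (A \<union> cls y) B" using position_alice[OF p y] .
  have q': "q + 1 \<notin> A \<union> cls y" "q + 2 \<notin> A \<union> cls y" using p' q unfolding position_def by blast+
  have "\<not> covers (A \<union> cls y) \<and> bob_moves (A \<union> cls y) B"
  proof (cases "q \<in> cls y")
    case False
    then have x: "q \<notin> A \<union> cls y \<union> B" using q by blast
    then have "\<not> covers (A \<union> cls y)" using q' by (intro not_coversI[of q]) blast+
    moreover have "bob_draws (A \<union> cls y) (B \<union> cls q)"
      by (rule bob_draws_triple[of _ _ q]) (use q position_bob[OF p' x] in auto)
    ultimately show ?thesis by (simp add: bob_movesI[OF x])
  next
    case True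
    then have "q + 3 \<notin> cls y" using cls_cong[of "q + 3" y q] cls_near[of "q + 3" q] n by auto
    then have x: "q + 3 \<notin> A \<union> cls y \<union> B" using q by blast
    then have "\<not> covers (A \<union> cls y)"
      using q' not_coversI[of "q + 1"] by (simp add: add.assoc)
    moreover have "bob_draws (A \<union> cls y) (B \<union> cls (q + 3))"
      by (rule bob_draws_triple[of _ _ "q + 1"]) (use q position_bob[OF p' x] in \<open>simp_all add: add.assoc\<close>)
    ultimately show ?thesis by (simp add: bob_movesI[OF x])
  qed
  then show "\<not> covers (A \<union> cls y)" "bob_moves (A \<union> cls y) B" by auto
qed

section \<open>A single gap between two stones of Alice\<close>

lemma vacant_length:
  assumes "periodic S" "S \<subseteq> U" "i \<in> S" "vacant U i j"
  shows "j \<le> i + n"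
proof (rule ccontr)
  assume "\<not> j \<le> i + n"
  moreover have "i + n * 1 \<in> U" using periodic_shift[OF assms(1)] assms by blast
  ultimately show False using assms(4) n_ge_3 unfolding vacant_def by auto
qed

text \<open>
  Up to rotation, the gap of length \<open>3 * m\<close> after \<open>i\<close> is the only one between two stones of Alice, so
  Bob is the responder \<open>P\<close> everywhere else.
\<close>

definition single_gap :: "int set \<Rightarrow> int set \<Rightarrow> int \<Rightarrow> nat \<Rightarrow> bool" where
  "single_gap A B i m \<longleftrightarrow> position A B \<and> B \<noteq> {} \<and> (\<forall>k\<in>A. k - 1 \<in> B \<or> k + 1 \<in> B) \<and>
     i \<in> A \<and> i + 3 * int m + 1 \<in> A \<and> vacant (B \<union> A) i (i + 3 * int m + 1) \<and>
     (\<forall>a\<in>A. \<forall>b\<in>A. a + 1 < b \<longrightarrow> vacant (B \<union> A) a b \<longrightarrow> a \<in> cls i)"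

text \<open>The two windows are disjoint and lie within one period, so one new stone meets at most
  one of them, and the middle of the other stays undominated.\<close>

lemma two_uncovered:
  assumes k: "k \<notin> A" "k + 1 \<notin> A" "k + 2 \<notin> A" and l: "l \<notin> A" "l + 1 \<notin> A" "l + 2 \<notin> A"
    and kl: "k + 3 \<le> l" "l + 2 < k + n"
  shows "\<not> covers (A \<union> cls y)"
proof
  assume cov: "covers (A \<union> cls y)"
  have "k \<in> cls y \<or> k + 1 \<in> cls y \<or> k + 2 \<in> cls y"
    using not_coversI[of k "A \<union> cls y"] cov k by blast
  then obtain u where u: "u \<in> cls y" "k \<le> u" "u \<le> k + 2" by fastforce
  have "l \<in> cls y \<or> l + 1 \<in> cls y \<or> l + 2 \<in> cls y"
    using not_coversI[of l "A \<union> cls y"] cov l by blast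
  then obtain v where v: "v \<in> cls y" "l \<le> v" "v \<le> l + 2" by fastforce
  have "v \<in> cls u" using cls_cong u v by blast
  then show False using cls_near[of v u] u v kl by simp
qed

lemma source_gadgetI:
  assumes "i \<in> Q" "i + 1 \<notin> P \<union> Q" "i + 2 \<in> P" "i + 3 \<notin> P \<union> Q" "i + 4 \<in> Q"
  shows "source P Q"
proof -
  have "i + 2 - 1 = i + 1" "i + 2 - 2 = i" "i + 2 + 1 = i + 3" "i + 2 + 2 = i + 4" by simp_all
  then show ?thesis unfolding source_def using assms by metis
qed

lemma offset_in_cls: "\<bar>j - c\<bar> < n \<Longrightarrow> i + j \<in> cls (i + c) \<longleftrightarrow> j = c"
  using cls_near[of "i + j" "i + c"] by auto

text \<open>The offending gap has at least 3 vertices, so a stone of Bob at \<open>i + 2\<close>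
  lies strictly inside every copy of it and makes the position sound.\<close>

lemma single_gapD:
  assumes g: "single_gap A B i m" and m: "m \<ge> 1"
  shows "\<And>j. 1 \<le> j \<Longrightarrow> j \<le> 3 * int m \<Longrightarrow> i + j \<notin> A \<union> B"
    and "3 * int m < n" and "sound (B \<union> cls (i + 2)) A"
proof -
  have p: "position A B" and per: "periodic A" "periodic B" using g unfolding single_gap_def position_def by auto
  have v: "vacant (B \<union> A) i (i + 3 * int m + 1)" and iA: "i \<in> A" using g unfolding single_gap_def by auto
  show e: "i + j \<notin> A \<union> B" if "1 \<le> j" "j \<le> 3 * int m" for j
    using v that unfolding vacant_def by auto
  show "3 * int m < n" using vacant_length[OF per(1) _ iA v] by simp
  have "i + 2 \<notin> A \<union> B" using e[of 2] m by simp
  then have "(B \<union> cls (i + 2)) \<inter> A = {}" using position_bob[OF p] unfolding position_def by blast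
  moreover have "\<not> vacant (B \<union> cls (i + 2) \<union> A) a b" if ab: "a \<in> A" "b \<in> A" "a + 1 < b" for a b
  proof
    assume vac: "vacant (B \<union> cls (i + 2) \<union> A) a b"
    then have "vacant (B \<union> A) a b" unfolding vacant_def by blast
    then have "a \<in> cls i" using g ab unfolding single_gap_def by blast
    then obtain k where k: "a = i + n * k" by (rule clsE)
    have "b - n * k \<in> A" using ab periodic_shift[OF per(1), of b "- k"] by simp
    then have "\<not> b - n * k < i + 3 * int m + 1" using v k ab unfolding vacant_def by force
    then have "a + 2 < b" using k m by simp
    moreover have "a + 2 \<in> cls (i + 2)" using \<open>a \<in> cls i\<close> unfolding cls_def by simp
    ultimately show False using vac unfolding vacant_def by force
  qed
  ultimately show "sound (B \<union> cls (i + 2)) A"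
    using g per unfolding sound_def single_gap_def by auto
qed

text \<open>Bob plays \<open>i + 2\<close>. In a gap of length 3 this stone is isolated between
  \<open>i\<close> and \<open>i + 4\<close>, hence a source. In a longer gap Bob would next play
  \<open>i + 3\<close> with a double threat, so Alice must reply at \<open>i + 1\<close>,
  \<open>i + 3\<close> or \<open>i + 4\<close>; only \<open>i + 3\<close> leaves a gap between two
  of her stones, shorter by 3.\<close>

lemma bob_moves_single_gap:
  "single_gap A B i (Suc m) \<Longrightarrow> bob_moves A B"
proof (induction m arbitrary: A B i)
  case (0 A B i)
  note D = single_gapD[OF 0, simplified]
  have x: "i + 2 \<notin> A \<union> B" using D(1)[of 2] by simp
  have "i \<in> A" "i + 4 \<in> A" using 0 unfolding single_gap_def by (auto simp: add.commute)
  moreover have "i + 1 \<notin> B \<union> cls (i + 2) \<union> A" "i + 3 \<notin> B \<union> cls (i + 2) \<union> A"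
    using D(1)[of 1] D(1)[of 3] D(2) offset_in_cls[of 1 2 i] offset_in_cls[of 3 2 i] by auto
  ultimately have "source (B \<union> cls (i + 2)) A"
    by (intro source_gadgetI[of i]) auto
  then have "winning (B \<union> cls (i + 2)) A" using D(3) unfolding winning_def by blast
  then show ?case using bob_draws_winning x by (intro bob_movesI[of "i + 2"]) auto
next
  case (Suc m A B i)
  define B' where "B' = B \<union> cls (i + 2)"
  note g = Suc.prems
  have D: "\<And>j. 1 \<le> j \<Longrightarrow> j \<le> 3 * int m + 6 \<Longrightarrow> i + j \<notin> A \<union> B" "3 * int m + 6 < n" "sound B' A"
    using single_gapD[OF g] unfolding B'_def by (auto simp: algebra_simps)
  have p: "position A B" and iA: "i \<in> A" using g unfolding single_gap_def by auto
  have x: "i + 2 \<notin> A \<union> B" using D(1)[of 2] by simp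
  have p': "position A B'" using position_bob[OF p x] unfolding B'_def .
  have per: "periodic B'" using p' unfolding position_def by blast
  have i2: "i + 2 \<in> B'" unfolding B'_def by simp
  have E: "i + j \<notin> A \<union> B'" if "1 \<le> j" "j \<le> 3 * int m + 6" "j \<noteq> 2" for j
    using D(1)[of j] that D(2) offset_in_cls[of j 2 i] unfolding B'_def by auto
  have "bob_draws A B'"
  proof (rule bob_drawsI)
    fix y assume y: "y \<notin> A \<union> B'"
    have py: "position (A \<union> cls y) B'" using position_alice[OF p' y] .
    show "\<not> covers (A \<union> cls y)"
    proof (rule two_uncovered[of "i + 1" _ "i + 4"])
      have A: "i + j \<notin> A" if "1 \<le> j" "j \<le> 6" for j using D(1)[of j] that by simp
      from A[of 1] A[of 2] A[of 3] A[of 4] A[of 5] A[of 6]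
      show "i + 1 \<notin> A" "i + 1 + 1 \<notin> A" "i + 1 + 2 \<notin> A" "i + 4 \<notin> A" "i + 4 + 1 \<notin> A" "i + 4 + 2 \<notin> A"
        by (simp_all add: add.assoc)
    qed (use D(2) in auto)
    consider "i + 1 \<in> cls y" | "i + 3 \<in> cls y" | "i + 4 \<in> cls y"
      | "i + 1 \<notin> cls y" "i + 3 \<notin> cls y" "i + 4 \<notin> cls y" by blast
    then show "bob_moves (A \<union> cls y) B'"
    proof cases
      case 1
      \<comment> \<open>Alice's stone is adjacent to Bob's \<open>i + 2\<close> and to her own
        \<open>i\<close>, so Bob need not answer it and gains a free move.\<close>
      have "sound (B' \<union> cls (i + 2)) (A \<union> cls (i + 1))"
        by (rule sound_answer[OF D(3)]) (use E[of 1] i2 p' iA in \<open>auto simp: position_def\<close>)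
      then have "sound B' (A \<union> cls y)" using cls_absorb[OF per i2] cls_eq[OF 1] by simp
      moreover have "\<not> covers B'"
        using not_coversI[of "i + 4" B'] E[of 4] E[of 5] E[of 6] by (auto simp: add.assoc)
      ultimately show ?thesis by (rule bob_moves_sound)
    next
      case 2
      have cl: "cls y = cls (i + 3)" using cls_eq[OF 2] by simp
      have "single_gap (A \<union> cls (i + 3)) B' (i + 3) (Suc m)"
        unfolding single_gap_def
      proof (intro conjI ballI impI)
        show "position (A \<union> cls (i + 3)) B'" using py cl by simp
        show "B' \<noteq> {}" using i2 by blast
        show "i + 3 \<in> A \<union> cls (i + 3)" by simp
        show "i + 3 + 3 * int (Suc m) + 1 \<in> A \<union> cls (i + 3)"
          using g unfolding single_gap_def by (simp add: algebra_simps)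
        show "vacant (B' \<union> (A \<union> cls (i + 3))) (i + 3) (i + 3 + 3 * int (Suc m) + 1)"
          unfolding vacant_def
        proof (intro allI impI)
          fix k assume k: "i + 3 < k" "k < i + 3 + 3 * int (Suc m) + 1"
          define j where "j = k - i"
          have j: "3 < j" "j \<le> 3 * int m + 6" "k = i + j" using k unfolding j_def by simp_all
          then show "k \<notin> B' \<union> (A \<union> cls (i + 3))"
            using E[of j] offset_in_cls[of j 3 i] D(2) by auto
        qed
      next
        fix k assume k: "k \<in> A \<union> cls (i + 3)"
        show "k - 1 \<in> B' \<or> k + 1 \<in> B'"
        proof (cases "k \<in> A")
          case True then show ?thesis using g unfolding single_gap_def B'_def by blast
        next
          case False
          then have "k - 1 \<in> cls (i + 2)" using k unfolding cls_def by (simp add: algebra_simps)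
          then show ?thesis unfolding B'_def by blast
        qed
      next
        fix a b assume ab: "a \<in> A \<union> cls (i + 3)" "b \<in> A \<union> cls (i + 3)" "a + 1 < b"
          and v: "vacant (B' \<union> (A \<union> cls (i + 3))) a b"
        show "a \<in> cls (i + 3)"
        proof (rule ccontr)
          assume "a \<notin> cls (i + 3)"
          then have a: "a \<in> A" using ab by blast
          have "b \<notin> A"
          proof
            assume "b \<in> A"
            then have "\<not> vacant (B' \<union> A) a b" using D(3) a ab(3) unfolding sound_def by blast
            then show False using v unfolding vacant_def by blast
          qed
          then have "b - 1 \<in> cls (i + 2)" using ab unfolding cls_def by (simp add: algebra_simps)
          then have "b - 1 \<in> B'" unfolding B'_def by blast
          then show False using v ab(3) unfolding vacant_def by force
        qed
      qed
      then show ?thesis using Suc.IH cl by simp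
    next
      case 3
      have cl: "cls y = cls (i + 4)" using cls_eq[OF 3] by simp
      have e: "i + 4 \<notin> B' \<union> A" using E[of 4] by auto
      have v: "vacant (B' \<union> A) (i + 2) (i + 4)"
        unfolding vacant_def
      proof (intro allI impI)
        fix k assume "i + 2 < k" "k < i + 4"
        then have "k = i + 3" by simp
        then show "k \<notin> B' \<union> A" using E[of 3] by auto
      qed
      \<comment> \<open>Besides keeping the position sound, \<open>i + 5\<close> leaves
        \<open>i + 2\<close> isolated between Alice's \<open>i\<close> and \<open>i + 4\<close>, a
        source of the second kind.\<close>
      have s: "sound (B' \<union> cls (i + 5)) (A \<union> cls (i + 4))"
        by (rule sound_answer[OF D(3) e]) (use E[of 5] i2 v in \<open>auto simp: add.commute\<close>)
      have f: "i + 1 \<notin> B' \<union> cls (i + 5) \<union> (A \<union> cls (i + 4))" "i + 3 \<notin> B' \<union> cls (i + 5) \<union> (A \<union> cls (i + 4))"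
        using E[of 1] E[of 3] D(2) offset_in_cls[of 1 5 i] offset_in_cls[of 1 4 i]
          offset_in_cls[of 3 5 i] offset_in_cls[of 3 4 i] by auto
      have "source (B' \<union> cls (i + 5)) (A \<union> cls (i + 4))"
        by (intro source_gadgetI[of i]) (use f iA i2 in auto)
      then have "winning (B' \<union> cls (i + 5)) (A \<union> cls y)" using s cl unfolding winning_def by simp
      moreover have "i + 5 \<notin> A \<union> cls y \<union> B'" using E[of 5] D(2) offset_in_cls[of 5 4 i] cl by auto
      ultimately show ?thesis using bob_draws_winning by (intro bob_movesI[of "i + 5"]) auto
    next
      case 4
      have x3: "i + 3 \<notin> A \<union> cls y \<union> B'" using E[of 3] 4 by auto
      have "bob_draws (A \<union> cls y) (B' \<union> cls (i + 3))"
      proof (rule bob_draws_double_threat[of _ _ "i + 1"])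
        show "position (A \<union> cls y) (B' \<union> cls (i + 3))" using position_bob[OF py x3] .
      qed (use E[of 1] E[of 4] 4 D(2) i2 offset_in_cls[of 1 3 i] offset_in_cls[of 4 3 i] in \<open>auto simp: add.assoc\<close>)
      then show ?thesis using x3 by (intro bob_movesI[of "i + 3"]) auto
    qed
  qed
  then show ?case using x unfolding B'_def by (intro bob_movesI[of "i + 2"]) auto
qed

section \<open>Bob's chase along the circle\<close>

lemma covers_if_period_covered:
  assumes "periodic S" and c: "\<And>k. a \<le> k \<Longrightarrow> k < a + n \<Longrightarrow> k - 1 \<in> S \<or> k \<in> S \<or> k + 1 \<in> S"
  shows "covers S"
  unfolding covers_def
proof
  fix i
  define k where "k = a + (i - a) mod n"
  have k: "a \<le> k" "k < a + n" using n_ge_3 unfolding k_def by simp_all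
  have "(i - a) - (i - a) mod n = n * ((i - a) div n)" by (simp add: minus_mod_eq_mult_div)
  then have "i = k + n * ((i - a) div n)" unfolding k_def by simp
  then have "i + e \<in> S \<longleftrightarrow> k + e \<in> S" for e
    using periodic_shift[OF assms(1), of "k + e" "(i - a) div n"] by (metis add.assoc add.commute)
  from this[of "- 1"] this[of 0] this[of 1] c[OF k]
  show "i - 1 \<in> S \<or> i \<in> S \<or> i + 1 \<in> S" by simp
qed

text \<open>
  Bob plays \<open>t + 2\<close> over and over, each time threatening \<open>t + 1\<close>, until the gap after \<open>t\<close> is filled or
  has length 3, according to its parity. Alice cannot win meanwhile because \<open>a + 2\<close> is not dominated by
  her.
\<close>

lemma bob_moves_chase:
  assumes "position A B" and "\<And>j. 1 \<le> j \<Longrightarrow> j \<le> 3 \<Longrightarrow> a + j \<notin> A \<union> B"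
    and "t \<in> B" "vacant (A \<union> B) t (a + n)" "a + 5 \<le> t" "t \<le> a + n - 1"
    and "even (a + n - t) \<Longrightarrow> t \<le> a + n - 4"
    and "\<And>k. a + 4 \<le> k \<Longrightarrow> k \<le> t \<Longrightarrow> k - 1 \<in> B \<or> k \<in> B \<or> k + 1 \<in> B"
  shows "bob_moves A B"
  using assms
proof (induction "nat (a + n - t)" arbitrary: A B t rule: less_induct)
  case less
  note p = less.prems(1) and e = less.prems(2) and t = less.prems(3,4,5,6,7) and d = less.prems(8)
  have per: "periodic A" "periodic B" using p unfolding position_def by auto
  have x2: "a + 2 \<notin> A \<union> B" using e[of 2] by simp
  have far: "t + j \<notin> A \<union> B" if "1 \<le> j" "t + j < a + n" for j
    using t(2) that unfolding vacant_def by simp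
  have tA: "t \<notin> A" using t(1) p unfolding position_def by blast
  \<comment> \<open>Length 1 of the gap after \<open>t\<close> is excluded by the parity hypothesis.
    What remains is an exhausted gap, length 3, and any other length of at least 2.\<close>
  have "t \<noteq> a + n - 2" using t(5) by auto
  then consider "t = a + n - 1" | "t = a + n - 4" | "t + 2 \<le> a + n - 1" "t \<noteq> a + n - 4" "t \<noteq> a + n - 2"
    using t(4) by linarith
  then show ?case
  proof cases
    case 1
    \<comment> \<open>\<open>t\<close> is a copy of \<open>a - 1\<close>, so Bob already dominates
      \<open>a\<close>, and \<open>a + 2\<close> takes care of the next three vertices.\<close>
    have "a - 1 \<in> B" using t(1) 1 periodic_shift[OF per(2), of "a - 1" 1] by (simp add: algebra_simps)
    have "covers (B \<union> cls (a + 2))"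
    proof (rule covers_if_period_covered[of _ a])
      fix k assume k: "a \<le> k" "k < a + n"
      consider "k = a" | "k + 1 = a + 2" | "k = a + 2" | "k - 1 = a + 2" | "a + 4 \<le> k" "k \<le> t" using k 1 by linarith
      then show "k - 1 \<in> B \<union> cls (a + 2) \<or> k \<in> B \<union> cls (a + 2) \<or> k + 1 \<in> B \<union> cls (a + 2)"
        using \<open>a - 1 \<in> B\<close> d[of k] cls_self[of "a + 2"] by cases (metis UnCI)+
    qed (use per in simp)
    then show ?thesis using x2 by (intro bob_movesI[of "a + 2"]) auto
  next
    case 2
    define B' where "B' = B \<union> cls (a + 2)"
    have p': "position A B'" using position_bob[OF p x2] unfolding B'_def .
    have b2: "a + 2 \<in> B'" unfolding B'_def by simp
    have far': "t + j \<notin> B'" if "1 \<le> j" "j \<le> 3" for j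
      using far[of j] that 2 cls_near[of "t + j" "a + 2"] t(3) unfolding B'_def by auto
    have e': "a + j \<notin> B'" if "j = 1 \<or> j = 3" for j
      using e[of j] that offset_in_cls[of j 2 a] n_ge_3 unfolding B'_def by auto
    \<comment> \<open>Besides \<open>a + 2\<close> and \<open>t\<close>, Bob needs one of
      \<open>t + 2\<close>, \<open>t + 3\<close> and one of \<open>a - 1\<close>,
      \<open>a + 1\<close>. As \<open>t + 3\<close> is a copy of \<open>a - 1\<close>, it does both
      and would win at once, so Alice has to take it.\<close>
    have cov: "covers S"
      if S: "periodic S" "B' \<subseteq> S" "t + 2 \<in> S \<or> t + 3 \<in> S" "a - 1 \<in> S \<or> a + 1 \<in> S" for S
    proof (rule covers_if_period_covered[OF S(1), of a])
      fix k assume k: "a \<le> k" "k < a + n"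
      have b: "a + 2 \<in> S" "t \<in> S" using S(2) b2 t(1) unfolding B'_def by auto
      consider "k = a" | "k + 1 = a + 2" | "k = a + 2" | "k - 1 = a + 2" | "a + 4 \<le> k" "k \<le> t"
        | "k - 1 = t" | "k = t + 2" "k + 1 = t + 3" | "k - 1 = t + 2" "k = t + 3"
        using k 2 by linarith
      then show "k - 1 \<in> S \<or> k \<in> S \<or> k + 1 \<in> S"
      proof cases
        case 5 then show ?thesis using d[of k] S(2) unfolding B'_def by auto
      qed (use b S(3,4) in metis)+
    qed
    have "bob_draws A B'"
    proof (rule bob_drawsI)
      fix y assume y: "y \<notin> A \<union> B'"
      have py: "position (A \<union> cls y) B'" using position_alice[OF p' y] .
      show "\<not> covers (A \<union> cls y)"
        by (rule two_uncovered[of "a + 1" _ t])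
          (use e[of 1] e[of 2] e[of 3] tA far[of 1] far[of 2] 2 t(3) in \<open>auto simp: add.assoc\<close>)
      show "bob_moves (A \<union> cls y) B'"
      proof (cases "t + 3 \<in> cls y")
        case False
        then have "t + 3 \<notin> A \<union> cls y \<union> B'" using far[of 3] far'[of 3] 2 by auto
        moreover have "covers (B' \<union> cls (t + 3))"
        proof (rule cov)
          have "a - 1 \<in> cls (t + 3)" using 2 unfolding cls_def by simp
          then show "a - 1 \<in> B' \<union> cls (t + 3) \<or> a + 1 \<in> B' \<union> cls (t + 3)" by blast
        qed (use p' in \<open>auto simp: position_def\<close>)
        ultimately show ?thesis by (intro bob_movesI[of "t + 3"]) auto
      next
        case True
        define A' where "A' = A \<union> cls y"
        have cl: "A' = A \<union> cls (t + 3)" unfolding A'_def using cls_eq[OF True] by simp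
        have eA: "a + j \<notin> A'" if "1 \<le> j" "j \<le> 3" for j
          using e[of j] that cls_near[of "a + j" "t + 3"] 2 t(3) unfolding cl by auto
        have fA: "t + j \<notin> A'" if "0 \<le> j" "j \<le> 2" for j
          using far[of j] tA that cls_near[of "t + j" "t + 3"] 2 t(3) unfolding cl by (cases "j = 0") auto
        have x1: "a + 1 \<notin> A' \<union> B'" using eA[of 1] e'[of 1] by auto
        \<comment> \<open>After Alice's \<open>t + 3\<close>, the stone \<open>a + 1\<close> makes
          two threats: \<open>t + 2\<close> would dominate, and \<open>a + 3\<close> would complete
          three consecutive vertices.\<close>
        define B'' where "B'' = B' \<union> cls (a + 1)"
        have p'': "position A' B''" using position_bob[OF py] x1 unfolding A'_def B''_def by blast
        have "bob_draws A' B''"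
        proof (rule bob_drawsI)
          fix z assume z: "z \<notin> A' \<union> B''"
          have pz: "position (A' \<union> cls z) B''" using position_alice[OF p'' z] .
          show "\<not> covers (A' \<union> cls z)"
            by (rule two_uncovered[of "a + 1" _ t])
              (use eA[of 1] eA[of 2] eA[of 3] fA[of 0] fA[of 1] fA[of 2] 2 t(3) in \<open>auto simp: add.assoc\<close>)
          have b3: "a + 3 \<notin> B''" using e'[of 3] offset_in_cls[of 3 1 a] n_ge_3 unfolding B''_def by auto
          show "bob_moves (A' \<union> cls z) B''"
          proof (cases "a + 3 \<in> cls z")
            case False
            then have x3: "a + 3 \<notin> A' \<union> cls z \<union> B''" using eA[of 3] b3 by auto
            have "bob_draws (A' \<union> cls z) (B'' \<union> cls (a + 3))"
              by (rule bob_draws_triple[of _ _ "a + 1"])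
                (use position_bob[OF pz x3] b2 in \<open>auto simp: B''_def add.assoc\<close>)
            then show ?thesis using x3 by (intro bob_movesI[of "a + 3"]) auto
          next
            case True
            have "t + 2 \<notin> cls z"
              using cls_cong[of "t + 2" z "a + 3"] True cls_near[of "t + 2" "a + 3"] 2 t(3) by auto
            then have "t + 2 \<notin> A' \<union> cls z \<union> B''"
              using fA[of 2] far'[of 2] cls_near[of "t + 2" "a + 1"] 2 t(3) unfolding B''_def by auto
            moreover have "covers (B'' \<union> cls (t + 2))"
              by (rule cov) (use p' in \<open>auto simp: position_def B''_def\<close>)
            ultimately show ?thesis by (intro bob_movesI[of "t + 2"]) auto
          qed
        qed
        then show ?thesis using x1 unfolding A'_def B''_def by (intro bob_movesI[of "a + 1"]) auto
      qed
    qed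
    then show ?thesis using x2 unfolding B'_def by (intro bob_movesI[of "a + 2"]) auto
  next
    case 3
    have x: "t + 2 \<notin> A \<union> B" and y: "t + 1 \<notin> A \<union> B" using far[of 2] far[of 1] 3 by auto
    define B' where "B' = B \<union> cls (t + 2)"
    have p': "position A B'" using position_bob[OF p x] unfolding B'_def .
    have y': "t + 1 \<notin> A \<union> B'" using y cls_near[of "t + 1" "t + 2"] n_ge_3 unfolding B'_def by auto
    have e': "a + j \<notin> A \<union> cls (t + 1) \<union> B'" if "1 \<le> j" "j \<le> 3" for j
      using e[OF that] that cls_near[of "a + j" "t + 1"] cls_near[of "a + j" "t + 2"] 3 t(3)
      unfolding B'_def by auto
    have "bob_draws A B'"
    proof (rule bob_draws_threat[OF p'])
      show "t \<in> B'" "t + 2 \<in> B'" using t(1) unfolding B'_def by auto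
      show "t + 1 \<notin> A \<union> B'" by (rule y')
      show "\<not> covers (A \<union> cls (t + 1))"
        by (rule not_coversI[of "a + 1"]) (use e'[of 1] e'[of 2] e'[of 3] in \<open>auto simp: add.assoc\<close>)
      \<comment> \<open>After the forced reply at \<open>t + 1\<close> the chase resumes from
        \<open>t + 2\<close>, with the gap shorter by 2 and of the same parity.\<close>
      show "bob_moves (A \<union> cls (t + 1)) B'"
      proof (rule less.hyps[of "t + 2"])
        show "nat (a + n - (t + 2)) < nat (a + n - t)" using 3 by simp
        show "position (A \<union> cls (t + 1)) B'" using position_alice[OF p' y'] .
        show "t + 2 \<in> B'" unfolding B'_def by simp
        show "vacant (A \<union> cls (t + 1) \<union> B') (t + 2) (a + n)"
          unfolding vacant_def
        proof (intro allI impI)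
          fix k assume k: "t + 2 < k" "k < a + n"
          then show "k \<notin> A \<union> cls (t + 1) \<union> B'"
            using far[of "k - t"] cls_near[of k "t + 1"] cls_near[of k "t + 2"] t(3) unfolding B'_def by auto
        qed
        show "a + 5 \<le> t + 2" "t + 2 \<le> a + n - 1" using 3 t(3) by auto
        show "t + 2 \<le> a + n - 4" if "even (a + n - (t + 2))"
        proof -
          have ev: "even (a + n - t)" using that by simp
          then have "t \<le> a + n - 4" by (rule t(5))
          \<comment> \<open>The even number \<open>a + n - t\<close> is at least 4 and is not 4 in
            this case, so it is at least 6 and the bound survives the subtraction of 2.\<close>
          moreover have "t \<noteq> a + n - 5" using ev by auto
          ultimately show ?thesis using 3 by simp
        qed
        fix k assume k: "a + 4 \<le> k" "k \<le> t + 2"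
        consider "k \<le> t" | "k = t + 1" | "k = t + 2" using k by linarith
        then show "k - 1 \<in> B' \<or> k \<in> B' \<or> k + 1 \<in> B'"
          using d[of k] k t(1) unfolding B'_def by cases auto
      qed (use e' in auto)
    qed
    then show ?thesis using x unfolding B'_def by (intro bob_movesI[of "t + 2"]) auto
  qed
qed

text \<open>After Bob's \<open>a + 5\<close>, a reply that is not adjacent to it allows a double
  threat on one side. The reply \<open>a + 6\<close> leads to a single gap of Alice, the reply
  \<open>a + 4\<close> to the chase.\<close>

lemma bob_draws_opening:
  assumes n: "n \<ge> 10" "n mod 3 = 1"
  shows "bob_draws {} {}"
proof (rule bob_drawsI)
  fix a :: int
  have off: "a + j \<in> cls (a + c) \<longleftrightarrow> j = c" "a + j \<in> cls a \<longleftrightarrow> j = 0"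
    if "0 \<le> j" "j < n" "0 \<le> c" "c < n" for j c
    using offset_in_cls[of j c a] offset_in_cls[of j 0 a] that by auto
  have nc: "\<not> covers (cls a \<union> cls y)" for y
    by (rule two_uncovered[of "a + 1" _ "a + 4"])
      (use n off[of 1 0] off[of 2 0] off[of 3 0] off[of 4 0] off[of 5 0] off[of 6 0] in \<open>auto simp: add.assoc\<close>)
  from nc[of a] show "\<not> covers ({} \<union> cls a)" by simp
  have a5: "a + 5 \<notin> cls a" using off[of 5 0] n by simp
  have p: "position (cls a) (cls (a + 5))"
    unfolding position_def using cls_disjoint[of "cls a" "a + 5"] a5 by auto
  have "bob_draws (cls a) (cls (a + 5))"
  proof (rule bob_drawsI)
    fix y assume y: "y \<notin> cls a \<union> cls (a + 5)"
    show "\<not> covers (cls a \<union> cls y)" by (rule nc)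
    have py: "position (cls a \<union> cls y) (cls (a + 5))" using position_alice[OF p y] .
    consider "a + 6 \<in> cls y" | "a + 4 \<in> cls y" | "a + 6 \<notin> cls y" "a + 4 \<notin> cls y" "a + 3 \<in> cls y"
      | "a + 6 \<notin> cls y" "a + 4 \<notin> cls y" "a + 3 \<notin> cls y" by blast
    then show "bob_moves (cls a \<union> cls y) (cls (a + 5))"
    proof cases
      case 1
      have cl: "cls y = cls (a + 6)" using cls_eq[OF 1] by simp
      \<comment> \<open>Alice's gap will run from \<open>a + 6\<close> to \<open>a + n\<close> and
        contain \<open>n - 7\<close> vertices, a positive multiple of 3 by the assumptions on
        \<open>n\<close>.\<close>
      define m where "m = nat ((n - 10) div 3)"
      have m: "3 * int (Suc m) = n - 7" using n unfolding m_def by (simp add: algebra_simps) presburger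
      \<comment> \<open>The position reached when Bob's \<open>a + 3\<close> forces
        \<open>a + 4\<close> and then his \<open>a + 1\<close> forces \<open>a + 2\<close>. The draw
        is derived backwards through these moves.\<close>
      define A where "A = cls a \<union> cls (a + 6) \<union> cls (a + 4) \<union> cls (a + 2)"
      define B where "B = cls (a + 5) \<union> cls (a + 3) \<union> cls (a + 1)"
      have offA: "a + j \<in> A \<longleftrightarrow> j = 0 \<or> j = 6 \<or> j = 4 \<or> j = 2"
        and offB: "a + j \<in> B \<longleftrightarrow> j = 5 \<or> j = 3 \<or> j = 1" if "0 \<le> j" "j < n" for j
        using that n off[of j 6] off[of j 4] off[of j 2] off[of j 5] off[of j 3] off[of j 1]
        unfolding A_def B_def by auto
      have p3: "position (cls a \<union> cls (a + 6)) (cls (a + 5) \<union> cls (a + 3))"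
        using position_bob[OF py[unfolded cl], of "a + 3"] n off[of 3 5] off[of 3 6] by simp
      have p4: "position (cls a \<union> cls (a + 6) \<union> cls (a + 4)) (cls (a + 5) \<union> cls (a + 3))"
        using position_alice[OF p3, of "a + 4"] n off[of 4 5] off[of 4 6] off[of 4 3] by simp
      have p1: "position (cls a \<union> cls (a + 6) \<union> cls (a + 4)) B"
        using position_bob[OF p4, of "a + 1"] n off[of 1 5] off[of 1 6] off[of 1 3] off[of 1 4]
        unfolding B_def by simp
      have pAB: "position A B"
        using position_alice[OF p1, of "a + 2"] n offB[of 2] off[of 2 6] off[of 2 4]
        unfolding A_def by simp
      have "single_gap A B (a + 6) (Suc m)"
        unfolding single_gap_def
      proof (intro conjI ballI impI)
        show "position A B" by (rule pAB)
        show "B \<noteq> {}" using offB[of 1] n by auto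
        show "a + 6 \<in> A" using offA[of 6] n by simp
        have "a + n * 1 \<in> A" using pAB offA[of 0] n periodic_shift[of A a 1] unfolding position_def by simp
        moreover have "a + 6 + 3 * int (Suc m) + 1 = a + n" using m by simp
        ultimately show "a + 6 + 3 * int (Suc m) + 1 \<in> A" by (metis mult.right_neutral)
        show "vacant (B \<union> A) (a + 6) (a + 6 + 3 * int (Suc m) + 1)"
          unfolding vacant_def
        proof (intro allI impI)
          fix k assume "a + 6 < k" "k < a + 6 + 3 * int (Suc m) + 1"
          then show "k \<notin> B \<union> A" using offA[of "k - a"] offB[of "k - a"] m by simp
        qed
        \<comment> \<open>Every stone of Alice other than the copies of \<open>a + 6\<close> is
          directly followed by one of Bob, so only those copies can start a gap of Alice.\<close>
        have shift: "k + 1 \<in> B" if k: "k \<in> cls a \<union> cls (a + 4) \<union> cls (a + 2)" for k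
        proof -
          have "k + 1 \<in> cls (a + 1) \<union> cls (a + 5) \<union> cls (a + 3)"
            using k unfolding cls_def by (auto simp: algebra_simps)
          then show ?thesis unfolding B_def by blast
        qed
        {
          fix k assume k: "k \<in> A"
          show "k - 1 \<in> B \<or> k + 1 \<in> B"
          proof (cases "k \<in> cls (a + 6)")
            case True
            then have "k - 1 \<in> cls (a + 5)" unfolding cls_def by (simp add: algebra_simps)
            then show ?thesis unfolding B_def by blast
          next
            case False then show ?thesis using shift k unfolding A_def by blast
          qed
        }
        fix k l assume kl: "k \<in> A" "l \<in> A" "k + 1 < l" "vacant (B \<union> A) k l"
        then have "k + 1 \<notin> B" unfolding vacant_def by force
        then show "k \<in> cls (a + 6)" using shift[of k] kl(1) unfolding A_def by blast
      qed
      then have "bob_moves A B" by (rule bob_moves_single_gap)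
      moreover have "\<not> covers A"
        by (rule not_coversI[of "a + 7"]) (use n offA[of 7] offA[of 8] offA[of 9] in \<open>auto simp: add.assoc\<close>)
      ultimately have "bob_draws (cls a \<union> cls (a + 6) \<union> cls (a + 4)) B"
        by (intro bob_draws_threat[OF p1, of "a + 1"])
          (use n offB[of 1] offB[of 2] offB[of 3] off[of 2 6] off[of 2 4] in \<open>auto simp: A_def add.assoc\<close>)
      then have m4: "bob_moves (cls a \<union> cls (a + 6) \<union> cls (a + 4)) (cls (a + 5) \<union> cls (a + 3))"
        using n off[of 1 6] off[of 1 4] off[of 1 5] off[of 1 3] unfolding B_def
        by (intro bob_movesI[of "a + 1"]) auto
      have "\<not> covers (cls a \<union> cls (a + 6) \<union> cls (a + 4))"
        by (rule not_coversI[of "a + 7"])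
          (use n offA[of 7] offA[of 8] offA[of 9] in \<open>auto simp: A_def add.assoc\<close>)
      then have "bob_draws (cls a \<union> cls (a + 6)) (cls (a + 5) \<union> cls (a + 3))"
        by (intro bob_draws_threat[OF p3, of "a + 3"])
          (use n m4 off[of 4 5] off[of 4 3] off[of 4 6] in \<open>auto simp: add.assoc\<close>)
      then show ?thesis unfolding cl using n off[of 3 6] off[of 3 5] by (intro bob_movesI[of "a + 3"]) auto
    next
      case 2
      have cl: "cls y = cls (a + 4)" using cls_eq[OF 2] by simp
      show ?thesis unfolding cl
      \<comment> \<open>The chase starts at Bob's \<open>a + 5\<close> and runs towards
        \<open>a + n\<close>, the next copy of Alice's first stone; its length condition holds since
        \<open>n \<ge> 10\<close>.\<close>
      proof (rule bob_moves_chase[of _ _ a "a + 5"])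
        show "position (cls a \<union> cls (a + 4)) (cls (a + 5))" using py cl by simp
        show "a + j \<notin> cls a \<union> cls (a + 4) \<union> cls (a + 5)" if "1 \<le> j" "j \<le> 3" for j
          using off[of j 4] off[of j 5] n that by auto
        show "vacant (cls a \<union> cls (a + 4) \<union> cls (a + 5)) (a + 5) (a + n)"
          unfolding vacant_def
        proof (intro allI impI)
          fix k assume "a + 5 < k" "k < a + n"
          then show "k \<notin> cls a \<union> cls (a + 4) \<union> cls (a + 5)"
            using off[of "k - a" 4] off[of "k - a" 5] n by auto
        qed
        fix k assume k: "a + 4 \<le> k" "k \<le> a + 5"
        then have "k = a + 4 \<or> k = a + 5" by linarith
        then show "k - 1 \<in> cls (a + 5) \<or> k \<in> cls (a + 5) \<or> k + 1 \<in> cls (a + 5)" by (auto simp: add.assoc)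
      qed (use n in auto)
    next
      case 3
      \<comment> \<open>Since \<open>a + 3\<close> is taken, the pair with two free neighbours is
        formed on the right side of \<open>a + 5\<close>.\<close>
      have x: "a + 6 \<notin> cls a \<union> cls y \<union> cls (a + 5)" using 3 n off[of 6 5] by auto
      have o: "a + 4 \<notin> cls a \<union> cls y \<union> (cls (a + 5) \<union> cls (a + 6))"
        using 3 n off[of 4 5] off[of 4 6] by auto
      have "a + 7 \<notin> cls y"
        using cls_cong[of "a + 7" y "a + 3"] 3 n off[of 7 3] by auto
      then have "a + 7 \<notin> cls a \<union> cls y \<union> (cls (a + 5) \<union> cls (a + 6))"
        using n off[of 7 5] off[of 7 6] by auto
      then have "bob_draws (cls a \<union> cls y) (cls (a + 5) \<union> cls (a + 6))"
        by (intro bob_draws_double_threat[OF position_bob[OF py x], of "a + 4"])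
          (use o n in \<open>auto simp: add.assoc\<close>)
      then show ?thesis using x by (intro bob_movesI[of "a + 6"]) auto
    next
      case 4
      have x: "a + 4 \<notin> cls a \<union> cls y \<union> cls (a + 5)" using 4 n off[of 4 5] by auto
      have "a + 3 \<notin> cls a \<union> cls y \<union> (cls (a + 5) \<union> cls (a + 4))"
        "a + 6 \<notin> cls a \<union> cls y \<union> (cls (a + 5) \<union> cls (a + 4))"
        using 4 n off[of 3 5] off[of 3 4] off[of 6 5] off[of 6 4] by auto
      then have "bob_draws (cls a \<union> cls y) (cls (a + 5) \<union> cls (a + 4))"
        by (intro bob_draws_double_threat[OF position_bob[OF py x], of "a + 3"])
          (use n in \<open>auto simp: add.assoc\<close>)
      then show ?thesis using x by (intro bob_movesI[of "a + 4"]) auto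
    qed
  qed
  then show "bob_moves ({} \<union> cls a) {}" using a5 by (intro bob_movesI[of "a + 5"]) auto
qed

section \<open>Transfer to the cycle graph\<close>

definition vtx :: "int \<Rightarrow> nat" where
  "vtx i = nat (i mod n)"

text \<open>The full preimage under the projection of the integers onto the cycle.\<close>

definition unroll :: "nat set \<Rightarrow> int set" where
  "unroll S = {i. vtx i \<in> S}"

lemma in_unroll [simp]: "i \<in> unroll S \<longleftrightarrow> vtx i \<in> S"
  by (simp add: unroll_def)

lemma int_vtx [simp]: "int (vtx i) = i mod n"
  using n_ge_3 by (simp add: vtx_def)

lemma vtx_less: "vtx i < nat n"
  using n_ge_3 by (simp add: vtx_def nat_less_iff)

lemma vtx_eq_iff: "v < nat n \<Longrightarrow> vtx i = v \<longleftrightarrow> n dvd i - int v"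
proof -
  assume "v < nat n"
  then have "int v mod n = int v" using n_ge_3 by simp
  then have "vtx i = v \<longleftrightarrow> i mod n = int v mod n" using int_vtx[of i] by (metis of_nat_eq_iff)
  then show ?thesis by (simp add: mod_eq_dvd_iff)
qed

lemma vtx_int [simp]: "v < nat n \<Longrightarrow> vtx (int v) = v"
  by (simp add: vtx_eq_iff)

lemma vtx_succ: "(vtx i + 1) mod nat n = vtx (i + 1)"
proof -
  have "int ((vtx i + 1) mod nat n) = (i mod n + 1) mod n" using n_ge_3 by (simp add: zmod_int add.commute)
  then show ?thesis using int_vtx[of "i + 1"] by (metis mod_add_left_eq of_nat_eq_iff)
qed

lemma vtx_pred: "u < nat n \<Longrightarrow> (u + 1) mod nat n = vtx i \<Longrightarrow> u = vtx (i - 1)"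
proof -
  assume u: "u < nat n" "(u + 1) mod nat n = vtx i"
  then have "vtx (int u + 1) = vtx i" using vtx_succ[of "int u"] by simp
  then have "n dvd (int u + 1) - i" using int_vtx[of "int u + 1"] int_vtx[of i] by (metis mod_eq_dvd_iff)
  then have "n dvd int u - (i - 1)" by (simp add: algebra_simps)
  then show ?thesis using vtx_eq_iff[OF u(1), of "i - 1"] dvd_diff_commute by metis
qed

lemma unroll_empty [simp]: "unroll {} = {}"
  by auto

lemma unroll_insert: "v < nat n \<Longrightarrow> unroll (insert v S) = unroll S \<union> cls (int v)"
  using vtx_eq_iff unfolding cls_def by auto

lemma unroll_insert_vtx: "unroll (insert (vtx i) S) = unroll S \<union> cls i"
proof -
  have "i \<in> cls (int (vtx i))" using vtx_eq_iff[OF vtx_less[of i]] unfolding cls_def by blast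
  then show ?thesis using unroll_insert[OF vtx_less] cls_eq by simp
qed

lemma dominating_iff_covers:
  assumes "S \<subseteq> {0..<nat n}"
  shows "dominating (cycle_graph (nat n)) S \<longleftrightarrow> covers (unroll S)"
proof
  assume dom: "dominating (cycle_graph (nat n)) S"
  show "covers (unroll S)" unfolding covers_def in_unroll
  proof
    fix i
    have "vtx i \<in> pverts (cycle_graph (nat n))" using vtx_less[of i] by (simp add: cycle_graph_def)
    then consider "vtx i \<in> S" | u where "u \<in> S" "(u, vtx i) \<in> parcs (cycle_graph (nat n))"
      using dom unfolding dominating_def by blast
    then show "vtx (i - 1) \<in> S \<or> vtx i \<in> S \<or> vtx (i + 1) \<in> S"
    proof cases
      case 2
      then have "u < nat n" "vtx i = (u + 1) mod nat n \<or> u = (vtx i + 1) mod nat n"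
        by (auto simp: cycle_graph_def)
      then have "u = vtx (i - 1) \<or> u = vtx (i + 1)" using vtx_pred[of u i] vtx_succ[of i] by auto
      then show ?thesis using 2 by blast
    qed simp
  qed
next
  assume cov: "covers (unroll S)"
  have "v \<in> S \<or> (\<exists>u\<in>S. (u, v) \<in> parcs (cycle_graph (nat n)))" if v: "v < nat n" for v
  proof -
    have "(vtx (int v + 1), v) \<in> parcs (cycle_graph (nat n))" "(vtx (int v - 1), v) \<in> parcs (cycle_graph (nat n))"
      using vtx_succ[of "int v"] vtx_succ[of "int v - 1"] vtx_less v by (simp_all add: cycle_graph_def)
    moreover have "vtx (int v - 1) \<in> S \<or> v \<in> S \<or> vtx (int v + 1) \<in> S"
      using cov vtx_int[OF v] unfolding covers_def in_unroll by metis
    ultimately show ?thesis by blast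
  qed
  then show "dominating (cycle_graph (nat n)) S"
    using assms unfolding dominating_def by (simp add: cycle_graph_def)
qed

lemma alice_wins_cycle:
  assumes "n mod 3 \<noteq> 1"
  shows "\<exists>\<sigma>. alice_winning_strategy (cycle_graph (nat n)) \<sigma>"
proof (rule alice_winning_strategy_from_invariant[of 0 _ "\<lambda>A B. winning (unroll A) (unroll B)"])
  have V: "pverts (cycle_graph (nat n)) = {0..<nat n}" by (simp add: cycle_graph_def)
  show "0 \<in> pverts (cycle_graph (nat n))" using n_ge_3 by (simp add: V)
  have "k \<notin> cls 0" if "0 < k" "k < n" for k using cls_near[of k 0] that by auto
  then have "vacant (cls 0) 0 n" unfolding vacant_def by blast
  \<comment> \<open>The only gap lies between the copies \<open>0\<close> and \<open>n\<close> of
    Alice's first stone, so the residue condition of a source is the assumption on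
    \<open>n\<close>.\<close>
  then have "source (cls 0) {}"
    unfolding source_def using assms n_ge_3
    by (intro disjI1 bexI[of _ 0] bexI[of _ n]) (auto simp: cls_def)
  moreover have "cls 0 \<noteq> {}" using cls_self by blast
  then have "sound (cls 0) {}" unfolding sound_def by simp
  moreover have "unroll {0} = cls 0" using unroll_insert[of 0 "{}"] n_ge_3 by simp
  ultimately show "winning (unroll {0}) (unroll {})" unfolding winning_def by simp
  fix A B :: "nat set"
  assume w: "winning (unroll A) (unroll B)" and sub: "A \<union> B \<subseteq> pverts (cycle_graph (nat n))"
    and nd: "\<not> dominating (cycle_graph (nat n)) A"
  have nc: "\<not> covers (unroll A)" using nd sub dominating_iff_covers[of A] by (simp add: V)
  \<comment> \<open>While Alice does not dominate, \<open>uncovered_end\<close> exhibits free cells,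
    so the board cannot be full.\<close>
  obtain i where "i \<notin> unroll A \<union> unroll B"
    using uncovered_end[of "unroll A" "unroll B"] w nc unfolding winning_def by blast
  then have "A \<union> B \<noteq> pverts (cycle_graph (nat n))" using vtx_less[of i] by (auto simp: V)
  moreover have "\<not> dominating (cycle_graph (nat n)) (insert x B) \<and>
      (\<exists>y\<in>pverts (cycle_graph (nat n)) - (A \<union> insert x B). winning (unroll (insert y A)) (unroll (insert x B)))"
    if x: "x \<in> pverts (cycle_graph (nat n)) - (A \<union> B)" for x
  proof
    have xn: "x < nat n" "int x \<notin> unroll A \<union> unroll B" using x by (auto simp: V)
    have "\<not> covers (unroll (insert x B))"
      using mover_not_covering[OF _ _ nc xn(2)] w unfolding winning_def unroll_insert[OF xn(1)] by blast
    then show "\<not> dominating (cycle_graph (nat n)) (insert x B)"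
      using dominating_iff_covers[of "insert x B"] sub xn(1) by (simp add: V)
    obtain y where y: "y \<notin> unroll A \<union> unroll B \<union> cls (int x)" "winning (unroll A \<union> cls y) (unroll B \<union> cls (int x))"
      using winning_answer[OF w nc xn(2)] by blast
    have "vtx y \<in> pverts (cycle_graph (nat n)) - (A \<union> insert x B)"
      using y(1) vtx_less[of y] unroll_insert[OF xn(1), of B] in_unroll[of y "insert x B"]
      by (auto simp: V)
    then show "\<exists>y\<in>pverts (cycle_graph (nat n)) - (A \<union> insert x B). winning (unroll (insert y A)) (unroll (insert x B))"
      using y(2) unroll_insert_vtx[of y A] unroll_insert[OF xn(1), of B] by metis
  qed
  ultimately show "A \<union> B \<noteq> pverts (cycle_graph (nat n)) \<and>
      (\<forall>x\<in>pverts (cycle_graph (nat n)) - (A \<union> B). \<not> dominating (cycle_graph (nat n)) (insert x B) \<and>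
        (\<exists>y\<in>pverts (cycle_graph (nat n)) - (A \<union> insert x B). winning (unroll (insert y A)) (unroll (insert x B))))"
    by blast
qed

lemma bob_draws_cycle:
  assumes "n \<ge> 10" "n mod 3 = 1"
  shows "\<not> alice_winning_strategy (cycle_graph (nat n)) \<sigma>"
\<comment> \<open>\<open>bob_draws\<close> speaks about positions after Alice's next move and is
  vacuous on a full board, so the invariant also records that she does not dominate yet.\<close>
proof (rule no_alice_winning_strategy_from_invariant
    [where J = "\<lambda>A B. bob_draws (unroll A) (unroll B) \<and> \<not> covers (unroll A)"])
  have V: "pverts (cycle_graph (nat n)) = {0..<nat n}" by (simp add: cycle_graph_def)
  then show "finite (pverts (cycle_graph (nat n)))" by simp
  show "bob_draws (unroll {}) (unroll {}) \<and> \<not> covers (unroll {})"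
    using bob_draws_opening[OF assms] by (simp add: covers_def)
  fix A B :: "nat set"
  assume J: "bob_draws (unroll A) (unroll B) \<and> \<not> covers (unroll A)"
    and sub: "A \<union> B \<subseteq> pverts (cycle_graph (nat n))"
  have dom: "dominating (cycle_graph (nat n)) S \<longleftrightarrow> covers (unroll S)" if "S \<subseteq> pverts (cycle_graph (nat n))" for S
    using dominating_iff_covers that by (simp add: V)
  have "\<not> dominating (cycle_graph (nat n)) (insert y A) \<and>
      (insert y A \<union> B = pverts (cycle_graph (nat n)) \<or>
       (\<exists>x\<in>pverts (cycle_graph (nat n)) - (insert y A \<union> B). dominating (cycle_graph (nat n)) (insert x B) \<or>
          bob_draws (unroll (insert y A)) (unroll (insert x B)) \<and> \<not> covers (unroll (insert y A))))"
    if y: "y \<in> pverts (cycle_graph (nat n)) - (A \<union> B)" for y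
  proof -
    have yn: "y < nat n" "int y \<notin> unroll A \<union> unroll B" using y by (auto simp: V)
    have u: "unroll (insert y A) = unroll A \<union> cls (int y)" using unroll_insert[OF yn(1)] .
    from J have "bob_draws (unroll A) (unroll B)" by blast
    then have "\<not> covers (unroll (insert y A)) \<and> (unroll (insert y A) \<union> unroll B = UNIV \<or>
        (\<exists>x. x \<notin> unroll (insert y A) \<union> unroll B \<and>
          (covers (unroll B \<union> cls x) \<or> bob_draws (unroll (insert y A)) (unroll B \<union> cls x))))"
      unfolding u using yn(2) by (elim bob_draws.cases) blast
    then have nc: "\<not> covers (unroll (insert y A))"
      and alt: "unroll (insert y A) \<union> unroll B = UNIV \<or> (\<exists>x. x \<notin> unroll (insert y A) \<union> unroll B \<and>
          (covers (unroll B \<union> cls x) \<or> bob_draws (unroll (insert y A)) (unroll B \<union> cls x)))"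
      by blast+
    have nd: "\<not> dominating (cycle_graph (nat n)) (insert y A)"
      using nc dom[of "insert y A"] sub y by auto
    from alt show ?thesis
    proof (elim disjE exE conjE)
      assume all: "unroll (insert y A) \<union> unroll B = UNIV"
      have "pverts (cycle_graph (nat n)) \<subseteq> insert y A \<union> B"
      proof
        fix v assume "v \<in> pverts (cycle_graph (nat n))"
        moreover have "int v \<in> unroll (insert y A) \<union> unroll B" unfolding all by simp
        ultimately show "v \<in> insert y A \<union> B" by (simp add: V)
      qed
      then have "insert y A \<union> B = pverts (cycle_graph (nat n))" using sub y by blast
      then show ?thesis using nd by blast
    next
      fix x assume x: "x \<notin> unroll (insert y A) \<union> unroll B"
      then have v: "vtx x \<in> pverts (cycle_graph (nat n)) - (insert y A \<union> B)"
        using vtx_less[of x] by (simp add: V)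
      have ux: "unroll B \<union> cls x = unroll (insert (vtx x) B)" using unroll_insert_vtx by simp
      {
        assume "covers (unroll B \<union> cls x)"
        then have "dominating (cycle_graph (nat n)) (insert (vtx x) B)"
          using dom[of "insert (vtx x) B"] v sub unfolding ux by blast
        then show ?thesis using nd v by blast
      next
        assume "bob_draws (unroll (insert y A)) (unroll B \<union> cls x)"
        then show ?thesis using nd nc v unfolding ux by blast
      }
    qed
  qed
  moreover have "\<not> dominating (cycle_graph (nat n)) A" using J sub dom[of A] by blast
  ultimately show "\<not> dominating (cycle_graph (nat n)) A \<and>
      (\<forall>y\<in>pverts (cycle_graph (nat n)) - (A \<union> B). \<not> dominating (cycle_graph (nat n)) (insert y A) \<and>
      (insert y A \<union> B = pverts (cycle_graph (nat n)) \<or>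
       (\<exists>x\<in>pverts (cycle_graph (nat n)) - (insert y A \<union> B). dominating (cycle_graph (nat n)) (insert x B) \<or>
          bob_draws (unroll (insert y A)) (unroll (insert x B)) \<and> \<not> covers (unroll (insert y A)))))"
    by blast
qed

end

section \<open>The exceptional cycles of length 4 and 7\<close>

lemma alice_wins_cycle_4: "\<exists>\<sigma>. alice_winning_strategy (cycle_graph 4) \<sigma>"
proof (rule alice_winning_strategy_from_invariant
    [of 0 _ "\<lambda>A B. A = {0} \<and> B = {} \<or> dominating (cycle_graph 4) A"])
  have V: "pverts (cycle_graph 4) = {0, 1, 2, 3}" by (auto simp: cycle_graph_def)
  show "0 \<in> pverts (cycle_graph 4)" by (simp add: V)
  fix A B :: "nat set"
  assume "A = {0} \<and> B = {} \<or> dominating (cycle_graph 4) A" "\<not> dominating (cycle_graph 4) A"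
  then have AB: "A = {0}" "B = {}" by auto
  \<comment> \<open>No single vertex dominates, but \<open>0\<close> together with any other vertex
    does, so Alice wins with her second stone.\<close>
  have "\<not> dominating (cycle_graph 4) {x}" if "x \<in> {1, 2, 3}" for x
    using that by (auto simp: dominating_def V) (auto simp: cycle_graph_def)
  moreover have "dominating (cycle_graph 4) {y, 0}" if "y \<in> {1, 2, 3}" for y
    using that by (auto simp: dominating_def V) (auto simp: cycle_graph_def)
  moreover have "\<exists>y\<in>{0, 1, 2, 3} - {0, x}. y \<in> {1, 2, 3}" for x :: nat
    by (cases "x = 1") auto
  ultimately show "A \<union> B \<noteq> pverts (cycle_graph 4) \<and> (\<forall>x\<in>pverts (cycle_graph 4) - (A \<union> B).
     \<not> dominating (cycle_graph 4) (insert x B) \<and> (\<exists>y\<in>pverts (cycle_graph 4) - (A \<union> insert x B).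
       insert y A = {0} \<and> insert x B = {} \<or> dominating (cycle_graph 4) (insert y A)))"
    unfolding AB V by fastforce
qed simp

lemma dominating_cycle_7:
  assumes "S \<subseteq> {0..<7}"
  shows "dominating (cycle_graph 7) S \<longleftrightarrow>
    (0 \<in> S \<or> 1 \<in> S \<or> 6 \<in> S) \<and>
    (1 \<in> S \<or> 2 \<in> S \<or> 0 \<in> S) \<and>
    (2 \<in> S \<or> 3 \<in> S \<or> 1 \<in> S) \<and>
    (3 \<in> S \<or> 4 \<in> S \<or> 2 \<in> S) \<and>
    (4 \<in> S \<or> 5 \<in> S \<or> 3 \<in> S) \<and>
    (5 \<in> S \<or> 6 \<in> S \<or> 4 \<in> S) \<and>
    (6 \<in> S \<or> 0 \<in> S \<or> 5 \<in> S)"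
proof -
  have V: "pverts (cycle_graph 7) = {0, 1, 2, 3, 4, 5, 6}" by (auto simp: cycle_graph_def)
  have sub: "S \<subseteq> pverts (cycle_graph 7)" using assms by (simp add: cycle_graph_def)
  \<comment> \<open>On natural numbers the predecessor modulo 7 is written as
    \<open>(v + 6) mod 7\<close>.\<close>
  have "(\<exists>u\<in>S. (u, v) \<in> parcs (cycle_graph 7)) \<longleftrightarrow> (v + 1) mod 7 \<in> S \<or> (v + 6) mod 7 \<in> S" if "v < 7" for v
  proof -
    have "(u, v) \<in> parcs (cycle_graph 7) \<longleftrightarrow> u = (v + 1) mod 7 \<or> u = (v + 6) mod 7" if "u < 7" for u
    proof -
      have "(u + 1) mod 7 = (if u = 6 then 0 else u + 1)" using that by simp
      moreover have "(v + 6) mod 7 = (if v = 0 then 6 else v - 1)"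
        using \<open>v < 7\<close> mod_add_self2[of "v - 1" 7] by (cases v) auto
      ultimately have "v = (u + 1) mod 7 \<longleftrightarrow> u = (v + 6) mod 7" using that \<open>v < 7\<close> by auto
      then show ?thesis using that \<open>v < 7\<close> unfolding cycle_graph_def by auto
    qed
    then have "(\<exists>u\<in>S. (u, v) \<in> parcs (cycle_graph 7)) \<longleftrightarrow> (\<exists>u\<in>S. u = (v + 1) mod 7 \<or> u = (v + 6) mod 7)"
      using assms by (intro bex_cong refl) auto
    then show ?thesis by blast
  qed
  from this[of 0] this[of 1] this[of 2] this[of 3] this[of 4] this[of 5] this[of 6] show ?thesis
    using sub unfolding dominating_def V by (simp add: numeral_2_eq_2)
qed

text \<open>Two stones dominate at most 6 vertices, so Bob cannot win before Alice places her third.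
  Her second stone goes opposite \<open>0\<close>, to whichever of \<open>3\<close> and
  \<open>4\<close> is available.\<close>

lemma alice_wins_cycle_7: "\<exists>\<sigma>. alice_winning_strategy (cycle_graph 7) \<sigma>"
proof (rule alice_winning_strategy_from_invariant
    [of 0 _ "\<lambda>A B. A = {0} \<and> B = {} \<or> (\<exists>x<7. B = {x} \<and> (A = {0, 3} \<or> A = {0, 4})) \<or> dominating (cycle_graph 7) A"])
  have V: "pverts (cycle_graph 7) = {0..<7}" by (simp add: cycle_graph_def)
  show "0 \<in> pverts (cycle_graph 7)" by (simp add: V)
  fix A B :: "nat set"
  assume I: "A = {0} \<and> B = {} \<or> (\<exists>x<7. B = {x} \<and> (A = {0, 3} \<or> A = {0, 4})) \<or> dominating (cycle_graph 7) A"
    and nd: "\<not> dominating (cycle_graph 7) A"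
  have nd2: "\<not> dominating (cycle_graph 7) {x, y}" if "x < 7" "y < 7" for x y
  proof -
    have "x = 0 \<or> x = 1 \<or> x = 2 \<or> x = 3 \<or> x = 4 \<or> x = 5 \<or> x = 6"
      "y = 0 \<or> y = 1 \<or> y = 2 \<or> y = 3 \<or> y = 4 \<or> y = 5 \<or> y = 6" using that by linarith+
    then show ?thesis by (elim disjE) (simp_all add: dominating_cycle_7)
  qed
  consider "A = {0}" "B = {}" | x where "x < 7" "B = {x}" "A = {0, 3} \<or> A = {0, 4}" using I nd by blast
  then show "A \<union> B \<noteq> pverts (cycle_graph 7) \<and> (\<forall>x\<in>pverts (cycle_graph 7) - (A \<union> B).
      \<not> dominating (cycle_graph 7) (insert x B) \<and> (\<exists>y\<in>pverts (cycle_graph 7) - (A \<union> insert x B).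
        insert y A = {0} \<and> insert x B = {} \<or>
        (\<exists>x'<7. insert x B = {x'} \<and> (insert y A = {0, 3} \<or> insert y A = {0, 4})) \<or>
        dominating (cycle_graph 7) (insert y A)))"
  proof cases
    case 1
    show ?thesis
    proof (intro conjI ballI)
      have "1 \<notin> A \<union> B" using 1 by simp
      then show "A \<union> B \<noteq> pverts (cycle_graph 7)" unfolding V by force
      fix x assume "x \<in> pverts (cycle_graph 7) - (A \<union> B)"
      then have x: "x < 7" "insert x B = {x}" using 1 by (auto simp: V)
      show "\<not> dominating (cycle_graph 7) (insert x B)" using nd2[of x x] x(1) 1(2) by simp
      define y :: nat where "y = (if x = 3 then 4 else 3)"
      have "y \<in> pverts (cycle_graph 7) - (A \<union> insert x B)" "insert y A = {0, 3} \<or> insert y A = {0, 4}"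
        using 1 unfolding y_def V by auto
      then show "\<exists>y\<in>pverts (cycle_graph 7) - (A \<union> insert x B). insert y A = {0} \<and> insert x B = {} \<or>
        (\<exists>x'<7. insert x B = {x'} \<and> (insert y A = {0, 3} \<or> insert y A = {0, 4})) \<or>
        dominating (cycle_graph 7) (insert y A)"
        using x by (intro bexI[of _ y]) blast+
    qed
  next
    case 2
    have "1 \<notin> A \<union> B \<or> 2 \<notin> A \<union> B" using 2 by auto
    then have neq: "A \<union> B \<noteq> pverts (cycle_graph 7)" unfolding V by force
    have ex: "\<exists>z\<in>{0..<7} - (A \<union> {y, x}). dominating (cycle_graph 7) (insert z A)" for y
    proof -
      \<comment> \<open>With \<open>0\<close> and \<open>3\<close> only vertex 5 is undominated,
        with \<open>0\<close> and \<open>4\<close> only vertex 2. Each can be dominated from the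
        three vertices of \<open>T\<close>, and Bob's two stones cannot occupy them all.\<close>
      define T where "T = (if 3 \<in> A then {4, 5, 6} else {1, 2, 3 :: nat})"
      have "\<not> T \<subseteq> {y, x}" unfolding T_def by auto
      then obtain z where z: "z \<in> T" "z \<notin> {y, x}" by blast
      then have "z \<in> {0..<7} - A" "dominating (cycle_graph 7) (insert z A)"
        using z(1) 2(3) unfolding T_def by (auto simp: dominating_cycle_7)
      then show ?thesis using z(2) by blast
    qed
    show ?thesis
    proof (intro conjI ballI)
      show "A \<union> B \<noteq> pverts (cycle_graph 7)" by (rule neq)
      fix y assume "y \<in> pverts (cycle_graph 7) - (A \<union> B)"
      then have "y < 7" by (simp add: V)
      then show "\<not> dominating (cycle_graph 7) (insert y B)" using nd2[of y x] 2(1,2) by simp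
      show "\<exists>z\<in>pverts (cycle_graph 7) - (A \<union> insert y B). insert z A = {0} \<and> insert y B = {} \<or>
        (\<exists>x'<7. insert y B = {x'} \<and> (insert z A = {0, 3} \<or> insert z A = {0, 4})) \<or>
        dominating (cycle_graph 7) (insert z A)"
        using ex[of y] unfolding 2(2) V by blast
    qed
  qed
qed simp

section \<open>The outcome on every cycle\<close>

theorem theorem3:
  fixes n :: nat
  assumes "n \<ge> 3"
  shows "(outcome (cycle_graph n) = \<D> \<longleftrightarrow> n \<ge> 10 \<and> [n = 1] (mod 3)) \<and>
         (\<not> (n \<ge> 10 \<and> [n = 1] (mod 3)) \<longrightarrow> outcome (cycle_graph n) = \<A>)"
proof -
  interpret circle "int n" by standard (use assms in simp)
  have mod3: "[n = 1] (mod 3) \<longleftrightarrow> int n mod 3 = 1"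
    using zmod_int[of n 3] unfolding cong_def by (simp, linarith)
  have "(\<exists>\<sigma>. alice_winning_strategy (cycle_graph n) \<sigma>) \<longleftrightarrow> \<not> (n \<ge> 10 \<and> [n = 1] (mod 3))"
  proof (cases "[n = 1] (mod 3)")
    case False
    then show ?thesis using alice_wins_cycle mod3 by simp
  next
    case True
    show ?thesis
    proof (cases "n \<ge> 10")
      case True
      then show ?thesis using bob_draws_cycle \<open>[n = 1] (mod 3)\<close> mod3 by simp
    next
      case False
      then have "n = 3 \<or> n = 4 \<or> n = 5 \<or> n = 6 \<or> n = 7 \<or> n = 8 \<or> n = 9" using assms by linarith
      then have "n = 4 \<or> n = 7" using True unfolding cong_def by (elim disjE) simp_all
      then show ?thesis using alice_wins_cycle_4 alice_wins_cycle_7 by auto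
    qed
  qed
  then show ?thesis unfolding outcome_def by auto
qed

end
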